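(* Let $F$ be a pre-simplicial set. Then the probability-law map $\mathbb{L}(F) \to \|F\|$ is a homotopy equivalence. In particular, $\mathbb{L}(F)$ has the homotopy type of a CW-complex.
   Context: $(\Omega,\lambda)$ is a fixed atomless complete probability space. $[n] = \{0,\dots,n\}$; $\mathbf{M}$ is the category with objects the $[n]$, $n\geq 0$, and morphisms the injective (strictly increasing) maps $[n]\to[m]$. A pre-simplicial set (also called semi-simplicial set, or $\Delta$-set) is a functor $F : \mathbf{M}^{op}\to\mathbf{Set}$; $F_n = F([n])$, and for $\sigma:[n]\to[m]$ in $\mathbf{M}$ and $\alpha\in F_m$ one writes $\alpha\sigma = F(\sigma)(\alpha)\in F_n$. $\nabla_n = L^1(\Omega,[n])$ is the set of measurable maps $f : \Omega \to [n]$ modulo almost everywhere equality, with the topology of the metric $d(f,g) = \lambda(\{t : f(t)\neq g(t)\})$; for $\sigma : [n]\to[m]$, $\nabla(\sigma) : \nabla_n \to \nabla_m$ is $f \mapsto \sigma\circ f$. $\Delta_n = \{(x_0,\dots,x_n) \in [0,1]^{n+1} : \sum x_i = 1\}$ and $\Delta(\sigma)(x_0,\dots,x_n) = (\sum_{j\in\sigma^{-1}(i)} x_j)_{i=0,\dots,m}$. $\|F\|$ is the quotient space of $\bigsqcup_n F_n\times\Delta_n$ ($F_n$ discrete) by the equivalence relation generated by $(\alpha\sigma,a)\sim(\alpha,\Delta(\sigma)(a))$ for $\sigma$ a morphism of $\mathbf{M}$; $\mathbb{L}(F)$ is the quotient space of $\bigsqcup_n F_n\times\nabla_n$ by the equivalence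 relation generated by $(\alpha\sigma,a)\sim(\alpha,\nabla(\sigma)(a))$ for $\sigma$ a morphism of $\mathbf{M}$. The maps $p_n:\nabla_n\to\Delta_n$, $f\mapsto(\lambda(f^{-1}(i)))_{i=0,\dots,n}$, are natural in $[n]$ and induce the probability-law map $\mathbb{L}(F)\to\|F\|$, sending the class of $(\alpha,a)$ to the class of $(\alpha,p_n(a))$. *)

theory Defs
  imports "HOL-Probability.Probability_Measure" "HOL-Homology.Simplices"
begin

section \<open>Quotient spaces and homotopy equivalences\<close>

text \<open>Points of the quotient space are the equivalence classes.\<close>

definition quotient_topology :: "'a topology \<Rightarrow> ('a \<times> 'a) set \<Rightarrow> 'a set topology" where
  "quotient_topology X E =
     topology (\<lambda>U. U \<subseteq> topspace X // E \<and> openin X {x \<in> topspace X. E `` {x} \<in> U})"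

lemma openin_quotient_topology:
  "openin (quotient_topology X E) U \<longleftrightarrow>
     U \<subseteq> topspace X // E \<and> openin X {x \<in> topspace X. E `` {x} \<in> U}"
proof -
  have "istopology (\<lambda>U. U \<subseteq> topspace X // E \<and> openin X {x \<in> topspace X. E `` {x} \<in> U})"
    unfolding istopology_def
  proof (rule conjI; intro allI impI)
    fix S T
    assume S: "S \<subseteq> topspace X // E \<and> openin X {x \<in> topspace X. E `` {x} \<in> S}"
      and T: "T \<subseteq> topspace X // E \<and> openin X {x \<in> topspace X. E `` {x} \<in> T}"
    have eq: "{x \<in> topspace X. E `` {x} \<in> S \<inter> T} =
        {x \<in> topspace X. E `` {x} \<in> S} \<inter> {x \<in> topspace X. E `` {x} \<in> T}"
      by auto
    show "S \<inter> T \<subseteq> topspace X // E \<and> openin X {x \<in> topspace X. E `` {x} \<in> S \<inter> T}"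
      unfolding eq using S T by (intro conjI le_infI1 openin_Int) simp_all
  next
    fix K
    assume K: "\<forall>S\<in>K. S \<subseteq> topspace X // E \<and> openin X {x \<in> topspace X. E `` {x} \<in> S}"
    have "{x \<in> topspace X. E `` {x} \<in> \<Union>K} = (\<Union>S\<in>K. {x \<in> topspace X. E `` {x} \<in> S})"
      by auto
    moreover have "openin X (\<Union>S\<in>K. {x \<in> topspace X. E `` {x} \<in> S})"
      using K by blast
    ultimately show "\<Union>K \<subseteq> topspace X // E \<and> openin X {x \<in> topspace X. E `` {x} \<in> \<Union>K}"
      using K by auto
  qed
  then show ?thesis
    by (simp add: quotient_topology_def topology_inverse')
qed

lemma topspace_quotient_topology [simp]:
  "topspace (quotient_topology X E) = topspace X // E"
proof
  show "topspace (quotient_topology X E) \<subseteq> topspace X // E"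
    by (metis openin_quotient_topology openin_topspace)
  have "{x \<in> topspace X. E `` {x} \<in> topspace X // E} = topspace X"
    by (auto intro: quotientI)
  then show "topspace X // E \<subseteq> topspace (quotient_topology X E)"
    by (intro openin_subset) (simp add: openin_quotient_topology)
qed

lemma quotient_map_quotient_topology:
  "quotient_map X (quotient_topology X E) (\<lambda>x. E `` {x})"
  unfolding quotient_map_def by (auto simp: openin_quotient_topology quotient_def)

definition generated_equiv :: "'a set \<Rightarrow> ('a \<Rightarrow> 'a \<Rightarrow> bool) \<Rightarrow> ('a \<times> 'a) set" where
  "generated_equiv S r = {(x, y). x \<in> S \<and> y \<in> S \<and> equivclp r x y}"

lemma equiv_generated_equiv: "equiv S (generated_equiv S r)"
  unfolding generated_equiv_def
  by (rule equivI)
    (auto simp: refl_on_def intro!: symI transI intro: equivclp_sym equivclp_trans)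

definition homotopy_equivalence :: "'a topology \<Rightarrow> 'b topology \<Rightarrow> ('a \<Rightarrow> 'b) \<Rightarrow> bool" where
  "homotopy_equivalence X Y f \<longleftrightarrow>
     continuous_map X Y f \<and>
     (\<exists>g. continuous_map Y X g \<and>
          homotopic_with (\<lambda>h. True) X X (g \<circ> f) id \<and>
          homotopic_with (\<lambda>h. True) Y Y (f \<circ> g) id)"

section \<open>CW complexes\<close>

definition closed_disc :: "nat \<Rightarrow> (nat \<Rightarrow> real) topology" where
  "closed_disc n = subtopology (Euclidean_space n) {x. (\<Sum>i<n. (x i)\<^sup>2) \<le> 1}"

definition open_disc :: "nat \<Rightarrow> (nat \<Rightarrow> real) topology" where
  "open_disc n = subtopology (Euclidean_space n) {x. (\<Sum>i<n. (x i)\<^sup>2) < 1}"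

definition disc_boundary :: "nat \<Rightarrow> (nat \<Rightarrow> real) set" where
  "disc_boundary n = {x \<in> topspace (Euclidean_space n). (\<Sum>i<n. (x i)\<^sup>2) = 1}"

text \<open>The set \<open>C\<close> consists of the open cells. They are nonempty and pairwise disjoint, so that
  the dimensions and the characteristic maps can be indexed by the cells themselves.\<close>

definition cw_structure ::
  "'a topology \<Rightarrow> 'a set set \<Rightarrow> ('a set \<Rightarrow> nat) \<Rightarrow> ('a set \<Rightarrow> (nat \<Rightarrow> real) \<Rightarrow> 'a) \<Rightarrow> bool" where
  "cw_structure X C dm \<Phi> \<longleftrightarrow>
     \<Union>C = topspace X \<and> pairwise disjnt C \<and>
     (\<forall>e\<in>C. continuous_map (closed_disc (dm e)) X (\<Phi> e) \<and>
             embedding_map (open_disc (dm e)) X (\<Phi> e) \<and>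
             \<Phi> e ` topspace (open_disc (dm e)) = e \<and>
             (\<exists>K. finite K \<and> K \<subseteq> {e' \<in> C. dm e' < dm e} \<and>
                  \<Phi> e ` disc_boundary (dm e) \<subseteq> \<Union>K)) \<and>
     (\<forall>A. A \<subseteq> topspace X \<and> (\<forall>e\<in>C. closedin X (A \<inter> X closure_of e)) \<longrightarrow> closedin X A)"

definition cw_complex :: "'a topology \<Rightarrow> bool" where
  "cw_complex X \<longleftrightarrow> Hausdorff_space X \<and> (\<exists>C dm \<Phi>. cw_structure X C dm \<Phi>)"

section \<open>Pre-simplicial sets and their realizations\<close>

text \<open>The object \<open>[n]\<close> is \<open>{..n}\<close>; morphisms are extensional functions, so that
  each one is represented exactly once.\<close>

definition mor :: "nat \<Rightarrow> nat \<Rightarrow> (nat \<Rightarrow> nat) set" where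
  "mor n m = {\<sigma> \<in> {..n} \<rightarrow>\<^sub>E {..m}. strict_mono_on {..n} \<sigma>}"

text \<open>A contravariant functor: \<open>act n m \<sigma> \<alpha>\<close> is \<open>\<alpha>\<sigma>\<close> for \<open>\<sigma> : [n] \<rightarrow> [m]\<close> and \<open>\<alpha> \<in> F m\<close>.\<close>

locale pre_simplicial_set =
  fixes F :: "nat \<Rightarrow> 'a set" and act :: "nat \<Rightarrow> nat \<Rightarrow> (nat \<Rightarrow> nat) \<Rightarrow> 'a \<Rightarrow> 'a"
  assumes act_closed: "\<And>n m \<sigma> \<alpha>. \<sigma> \<in> mor n m \<Longrightarrow> \<alpha> \<in> F m \<Longrightarrow> act n m \<sigma> \<alpha> \<in> F n"
    and act_id: "\<And>n \<alpha>. \<alpha> \<in> F n \<Longrightarrow> act n n (restrict id {..n}) \<alpha> = \<alpha>"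
    and act_compose: "\<And>n m k \<sigma> \<tau> \<alpha>. \<sigma> \<in> mor n m \<Longrightarrow> \<tau> \<in> mor m k \<Longrightarrow> \<alpha> \<in> F k \<Longrightarrow>
           act n k (compose {..n} \<tau> \<sigma>) \<alpha> = act n m \<sigma> (act m k \<tau> \<alpha>)"

text \<open>Realization with respect to a covariant functor to topological spaces, given by the spaces
  \<open>T n\<close> and the maps \<open>G n m \<sigma> : T n \<rightarrow> T m\<close>.\<close>

definition total_space ::
  "(nat \<Rightarrow> 'a set) \<Rightarrow> (nat \<Rightarrow> 'b topology) \<Rightarrow> (nat \<times> 'a \<times> 'b) topology" where
  "total_space F T = sum_topology (\<lambda>n. prod_topology (discrete_topology (F n)) (T n)) UNIV"

definition glue ::
  "(nat \<Rightarrow> 'a set) \<Rightarrow> (nat \<Rightarrow> nat \<Rightarrow> (nat \<Rightarrow> nat) \<Rightarrow> 'a \<Rightarrow> 'a) \<Rightarrow>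
   (nat \<Rightarrow> 'b topology) \<Rightarrow> (nat \<Rightarrow> nat \<Rightarrow> (nat \<Rightarrow> nat) \<Rightarrow> 'b \<Rightarrow> 'b) \<Rightarrow>
   nat \<times> 'a \<times> 'b \<Rightarrow> nat \<times> 'a \<times> 'b \<Rightarrow> bool" where
  "glue F act T G z w \<longleftrightarrow>
     (\<exists>n m \<sigma> \<alpha> a. \<sigma> \<in> mor n m \<and> \<alpha> \<in> F m \<and> a \<in> topspace (T n) \<and>
        z = (n, act n m \<sigma> \<alpha>, a) \<and> w = (m, \<alpha>, G n m \<sigma> a))"

definition glue_equiv ::
  "(nat \<Rightarrow> 'a set) \<Rightarrow> (nat \<Rightarrow> nat \<Rightarrow> (nat \<Rightarrow> nat) \<Rightarrow> 'a \<Rightarrow> 'a) \<Rightarrow>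
   (nat \<Rightarrow> 'b topology) \<Rightarrow> (nat \<Rightarrow> nat \<Rightarrow> (nat \<Rightarrow> nat) \<Rightarrow> 'b \<Rightarrow> 'b) \<Rightarrow>
   ((nat \<times> 'a \<times> 'b) \<times> (nat \<times> 'a \<times> 'b)) set" where
  "glue_equiv F act T G = generated_equiv (topspace (total_space F T)) (glue F act T G)"

definition realization ::
  "(nat \<Rightarrow> 'a set) \<Rightarrow> (nat \<Rightarrow> nat \<Rightarrow> (nat \<Rightarrow> nat) \<Rightarrow> 'a \<Rightarrow> 'a) \<Rightarrow>
   (nat \<Rightarrow> 'b topology) \<Rightarrow> (nat \<Rightarrow> nat \<Rightarrow> (nat \<Rightarrow> nat) \<Rightarrow> 'b \<Rightarrow> 'b) \<Rightarrow>
   (nat \<times> 'a \<times> 'b) set topology" where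
  "realization F act T G = quotient_topology (total_space F T) (glue_equiv F act T G)"

section \<open>The functors \<open>\<Delta>\<close> and \<open>\<nabla>\<close>\<close>

definition Delta :: "nat \<Rightarrow> (nat \<Rightarrow> real) topology" where
  "Delta n = subtopology (powertop_real UNIV) (standard_simplex n)"

definition Delta_map :: "nat \<Rightarrow> nat \<Rightarrow> (nat \<Rightarrow> nat) \<Rightarrow> (nat \<Rightarrow> real) \<Rightarrow> nat \<Rightarrow> real" where
  "Delta_map n m \<sigma> x = (\<lambda>i. \<Sum>j | j \<le> n \<and> \<sigma> j = i. x j)"

definition atomless :: "'w measure \<Rightarrow> bool" where
  "atomless M \<longleftrightarrow>
     (\<forall>A\<in>sets M. 0 < emeasure M A \<longrightarrow>
        (\<exists>B\<in>sets M. B \<subseteq> A \<and> 0 < emeasure M B \<and> emeasure M B < emeasure M A))"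

definition ae_equiv :: "'w measure \<Rightarrow> nat \<Rightarrow> (('w \<Rightarrow> nat) \<times> ('w \<Rightarrow> nat)) set" where
  "ae_equiv M n = {(f, g). f \<in> M \<rightarrow>\<^sub>M count_space {..n} \<and> g \<in> M \<rightarrow>\<^sub>M count_space {..n} \<and>
                           (AE t in M. f t = g t)}"

definition nabla_points :: "'w measure \<Rightarrow> nat \<Rightarrow> ('w \<Rightarrow> nat) set set" where
  "nabla_points M n = (M \<rightarrow>\<^sub>M count_space {..n}) // ae_equiv M n"

text \<open>Functions of a class modulo almost everywhere equality are evaluated on all representatives;
  the resulting set is a singleton (\<open>nabla_dist_class\<close> and \<open>prob_law_class\<close> below).
  Outside of \<open>nabla_points\<close> the distance is \<open>0\<close> because \<^locale>\<open>Metric_space\<close> wants a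
  symmetric nonnegative function on the whole type.\<close>

definition nabla_dist ::
  "'w measure \<Rightarrow> nat \<Rightarrow> ('w \<Rightarrow> nat) set \<Rightarrow> ('w \<Rightarrow> nat) set \<Rightarrow> real" where
  "nabla_dist M n U V =
     (if U \<in> nabla_points M n \<and> V \<in> nabla_points M n
      then the_elem ((\<lambda>(f, g). measure M {t \<in> space M. f t \<noteq> g t}) ` (U \<times> V))
      else 0)"

definition Nabla :: "'w measure \<Rightarrow> nat \<Rightarrow> ('w \<Rightarrow> nat) set topology" where
  "Nabla M n = Metric_space.mtopology (nabla_points M n) (nabla_dist M n)"

definition Nabla_map ::
  "'w measure \<Rightarrow> nat \<Rightarrow> nat \<Rightarrow> (nat \<Rightarrow> nat) \<Rightarrow> ('w \<Rightarrow> nat) set \<Rightarrow> ('w \<Rightarrow> nat) set" where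
  "Nabla_map M n m \<sigma> U = ae_equiv M m `` ((\<lambda>f. \<sigma> \<circ> f) ` U)"

definition prob_law :: "'w measure \<Rightarrow> ('w \<Rightarrow> nat) set \<Rightarrow> nat \<Rightarrow> real" where
  "prob_law M U = the_elem ((\<lambda>f i. measure M (f -` {i} \<inter> space M)) ` U)"

definition geometric_realization ::
  "(nat \<Rightarrow> 'a set) \<Rightarrow> (nat \<Rightarrow> nat \<Rightarrow> (nat \<Rightarrow> nat) \<Rightarrow> 'a \<Rightarrow> 'a) \<Rightarrow>
   (nat \<times> 'a \<times> (nat \<Rightarrow> real)) set topology" where
  "geometric_realization F act = realization F act Delta Delta_map"

definition random_realization ::
  "'w measure \<Rightarrow> (nat \<Rightarrow> 'a set) \<Rightarrow> (nat \<Rightarrow> nat \<Rightarrow> (nat \<Rightarrow> nat) \<Rightarrow> 'a \<Rightarrow> 'a) \<Rightarrow>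
   (nat \<times> 'a \<times> ('w \<Rightarrow> nat) set) set topology" where
  "random_realization M F act = realization F act (Nabla M) (Nabla_map M)"

text \<open>The image of a class is the class of the image of any representative, see
  \<open>law_map_class\<close> below.\<close>

definition law_map ::
  "'w measure \<Rightarrow> (nat \<Rightarrow> 'a set) \<Rightarrow> (nat \<Rightarrow> nat \<Rightarrow> (nat \<Rightarrow> nat) \<Rightarrow> 'a \<Rightarrow> 'a) \<Rightarrow>
   (nat \<times> 'a \<times> ('w \<Rightarrow> nat) set) set \<Rightarrow> (nat \<times> 'a \<times> (nat \<Rightarrow> real)) set" where
  "law_map M F act C =
     glue_equiv F act Delta Delta_map `` ((\<lambda>(n, \<alpha>, a). (n, \<alpha>, prob_law M a)) ` C)"

section \<open>The definitions on classes do not depend on representatives\<close>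

lemma equiv_ae_equiv: "equiv (M \<rightarrow>\<^sub>M count_space {..n}) (ae_equiv M n)"
proof (rule equivI)
  show "trans (ae_equiv M n)"
  proof (rule transI)
    fix f g h
    assume fg: "(f, g) \<in> ae_equiv M n" and gh: "(g, h) \<in> ae_equiv M n"
    have "AE t in M. f t = g t" "AE t in M. g t = h t"
      using fg gh by (auto simp: ae_equiv_def)
    then have "AE t in M. f t = h t"
      by eventually_elim simp
    then show "(f, h) \<in> ae_equiv M n"
      using fg gh by (auto simp: ae_equiv_def)
  qed
qed (auto simp: ae_equiv_def refl_on_def sym_def eq_commute)

lemma measurable_vimage_set:
  fixes f :: "'w \<Rightarrow> nat"
  assumes "f \<in> M \<rightarrow>\<^sub>M count_space {..n}"
  shows "f -` A \<inter> space M \<in> sets M"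
proof -
  have "f \<in> M \<rightarrow>\<^sub>M count_space UNIV"
    using measurable_compose[OF assms, of "\<lambda>i. i" "count_space UNIV"] by simp
  then show ?thesis
    by (rule measurable_sets) simp
qed

lemma measurable_neq_set:
  fixes f g :: "'w \<Rightarrow> nat"
  assumes "f \<in> M \<rightarrow>\<^sub>M count_space {..n}" "g \<in> M \<rightarrow>\<^sub>M count_space {..n}"
  shows "{t \<in> space M. f t \<noteq> g t} \<in> sets M"
proof -
  have "{t \<in> space M. f t \<noteq> g t} = (\<Union>i. (f -` {i} \<inter> space M) \<inter> (g -` (- {i}) \<inter> space M))"
    by auto
  then show ?thesis
    using assms by (auto intro!: sets.countable_UN sets.Int measurable_vimage_set)
qed

lemma nabla_points_cases:
  assumes "U \<in> nabla_points M n"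
  obtains f where "f \<in> M \<rightarrow>\<^sub>M count_space {..n}" "U = ae_equiv M n `` {f}"
  using assms unfolding nabla_points_def by (elim quotientE) blast

context prob_space
begin

lemma nabla_dist_class:
  assumes f: "f \<in> M \<rightarrow>\<^sub>M count_space {..n}" and g: "g \<in> M \<rightarrow>\<^sub>M count_space {..n}"
  shows "nabla_dist M n (ae_equiv M n `` {f}) (ae_equiv M n `` {g}) =
    prob {t \<in> space M. f t \<noteq> g t}"
proof -
  have *: "prob {t \<in> space M. f' t \<noteq> g' t} = prob {t \<in> space M. f t \<noteq> g t}"
    if f': "(f, f') \<in> ae_equiv M n" and g': "(g, g') \<in> ae_equiv M n" for f' g'
  proof (rule finite_measure_eq_AE)
    have "AE t in M. f t = f' t" "AE t in M. g t = g' t"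
      using f' g' by (auto simp: ae_equiv_def)
    then show "AE t in M. t \<in> {t \<in> space M. f' t \<noteq> g' t} \<longleftrightarrow> t \<in> {t \<in> space M. f t \<noteq> g t}"
      by eventually_elim auto
  qed (use f' g' in \<open>auto simp: ae_equiv_def intro: measurable_neq_set\<close>)
  have ff: "(f, f) \<in> ae_equiv M n" and gg: "(g, g) \<in> ae_equiv M n"
    using f g by (simp_all add: ae_equiv_def)
  have "the_elem ((\<lambda>(f, g). prob {t \<in> space M. f t \<noteq> g t}) `
      (ae_equiv M n `` {f} \<times> ae_equiv M n `` {g})) =
      (\<lambda>(f, g). prob {t \<in> space M. f t \<noteq> g t}) (f, g)"
  proof (rule the_elem_image_unique)
    show "ae_equiv M n `` {f} \<times> ae_equiv M n `` {g} \<noteq> {}"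
      using ff gg by blast
    fix z
    assume "z \<in> ae_equiv M n `` {f} \<times> ae_equiv M n `` {g}"
    then obtain f' g' where "z = (f', g')" "(f, f') \<in> ae_equiv M n" "(g, g') \<in> ae_equiv M n"
      by blast
    then show "(\<lambda>(f, g). prob {t \<in> space M. f t \<noteq> g t}) z =
        (\<lambda>(f, g). prob {t \<in> space M. f t \<noteq> g t}) (f, g)"
      by (simp only: prod.case *)
  qed
  moreover have "ae_equiv M n `` {f} \<in> nabla_points M n" "ae_equiv M n `` {g} \<in> nabla_points M n"
    using f g by (auto simp: nabla_points_def intro: quotientI)
  ultimately show ?thesis
    unfolding nabla_dist_def by (simp only: simp_thms if_True prod.case)
qed

lemma prob_law_class:
  assumes f: "f \<in> M \<rightarrow>\<^sub>M count_space {..n}"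
  shows "prob_law M (ae_equiv M n `` {f}) = (\<lambda>i. prob (f -` {i} \<inter> space M))"
proof -
  have *: "prob (f' -` {i} \<inter> space M) = prob (f -` {i} \<inter> space M)"
    if f': "(f, f') \<in> ae_equiv M n" for f' i
  proof (rule finite_measure_eq_AE)
    have "AE t in M. f t = f' t"
      using f' by (auto simp: ae_equiv_def)
    then show "AE t in M. t \<in> f' -` {i} \<inter> space M \<longleftrightarrow> t \<in> f -` {i} \<inter> space M"
      by eventually_elim auto
  qed (use f' in \<open>auto simp: ae_equiv_def intro: measurable_vimage_set\<close>)
  have "(f, f) \<in> ae_equiv M n"
    using f by (auto simp: ae_equiv_def)
  then have "ae_equiv M n `` {f} \<noteq> {}"
    by blast
  then show ?thesis
    unfolding prob_law_def by (rule the_elem_image_unique) (rule ext, rule *, blast)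
qed

lemma Metric_space_nabla: "Metric_space (nabla_points M n) (nabla_dist M n)"
proof
  show "0 \<le> nabla_dist M n U V" for U V
  proof (cases "U \<in> nabla_points M n \<and> V \<in> nabla_points M n")
    case True
    then obtain f g
      where "f \<in> M \<rightarrow>\<^sub>M count_space {..n}" "U = ae_equiv M n `` {f}"
        and "g \<in> M \<rightarrow>\<^sub>M count_space {..n}" "V = ae_equiv M n `` {g}"
      by (elim conjE nabla_points_cases)
    then show ?thesis
      by (simp add: nabla_dist_class)
  qed (simp only: nabla_dist_def if_False order_refl)
next
  show "nabla_dist M n U V = nabla_dist M n V U" for U V
  proof (cases "U \<in> nabla_points M n \<and> V \<in> nabla_points M n")
    case True
    then obtain f g
      where "f \<in> M \<rightarrow>\<^sub>M count_space {..n}" "U = ae_equiv M n `` {f}"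
        and "g \<in> M \<rightarrow>\<^sub>M count_space {..n}" "V = ae_equiv M n `` {g}"
      by (elim conjE nabla_points_cases)
    moreover have "{t \<in> space M. f t \<noteq> g t} = {t \<in> space M. g t \<noteq> f t}"
      by auto
    ultimately show ?thesis
      by (simp add: nabla_dist_class)
  qed (auto simp: nabla_dist_def)
next
  fix U V
  assume "U \<in> nabla_points M n" "V \<in> nabla_points M n"
  then obtain f g
    where f: "f \<in> M \<rightarrow>\<^sub>M count_space {..n}" "U = ae_equiv M n `` {f}"
      and g: "g \<in> M \<rightarrow>\<^sub>M count_space {..n}" "V = ae_equiv M n `` {g}"
    by (elim nabla_points_cases)
  have "nabla_dist M n U V = 0 \<longleftrightarrow> {t \<in> space M. f t \<noteq> g t} \<in> null_sets M"
    using f g by (simp add: nabla_dist_class null_sets_def measurable_neq_set emeasure_eq_measure)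
  also have "\<dots> \<longleftrightarrow> (AE t in M. f t = g t)"
    using AE_iff_null[of M "\<lambda>t. f t = g t"] measurable_neq_set[OF f(1) g(1)] by simp
  also have "\<dots> \<longleftrightarrow> (f, g) \<in> ae_equiv M n"
    using f g by (simp add: ae_equiv_def)
  also have "\<dots> \<longleftrightarrow> U = V"
    using eq_equiv_class_iff[OF equiv_ae_equiv f(1) g(1)] f(2) g(2) by simp
  finally show "nabla_dist M n U V = 0 \<longleftrightarrow> U = V" .
next
  fix U V W
  assume "U \<in> nabla_points M n" "V \<in> nabla_points M n" "W \<in> nabla_points M n"
  then obtain f g h
    where f: "f \<in> M \<rightarrow>\<^sub>M count_space {..n}" "U = ae_equiv M n `` {f}"
      and g: "g \<in> M \<rightarrow>\<^sub>M count_space {..n}" "V = ae_equiv M n `` {g}"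
      and h: "h \<in> M \<rightarrow>\<^sub>M count_space {..n}" "W = ae_equiv M n `` {h}"
    by (elim nabla_points_cases)
  have "prob {t \<in> space M. f t \<noteq> h t} \<le>
      prob ({t \<in> space M. f t \<noteq> g t} \<union> {t \<in> space M. g t \<noteq> h t})"
    using f g h by (intro finite_measure_mono) (auto intro!: sets.Un measurable_neq_set)
  also have "\<dots> \<le> prob {t \<in> space M. f t \<noteq> g t} + prob {t \<in> space M. g t \<noteq> h t}"
    using f g h by (intro measure_Un_le measurable_neq_set)
  finally show "nabla_dist M n U W \<le> nabla_dist M n U V + nabla_dist M n V W"
    using f g h by (simp add: nabla_dist_class)
qed

lemma topspace_Nabla [simp]: "topspace (Nabla M n) = nabla_points M n"
  by (simp add: Nabla_def Metric_space.topspace_mtopology Metric_space_nabla)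

end

lemma mor_imp_le:
  assumes "\<sigma> \<in> mor n m" "i \<le> n"
  shows "\<sigma> i \<le> m"
  using assms by (auto simp: mor_def PiE_iff)

lemma comp_measurable_mor:
  assumes "f \<in> M \<rightarrow>\<^sub>M count_space {..n}" "\<sigma> \<in> mor n m"
  shows "\<sigma> \<circ> f \<in> M \<rightarrow>\<^sub>M count_space {..m}"
proof (rule measurable_comp[OF assms(1)])
  show "\<sigma> \<in> count_space {..n} \<rightarrow>\<^sub>M count_space {..m}"
    using assms(2) by (auto simp: mor_imp_le)
qed

lemma Nabla_map_class:
  assumes f: "f \<in> M \<rightarrow>\<^sub>M count_space {..n}" and \<sigma>: "\<sigma> \<in> mor n m"
  shows "Nabla_map M n m \<sigma> (ae_equiv M n `` {f}) = ae_equiv M m `` {\<sigma> \<circ> f}"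
proof -
  have *: "(\<sigma> \<circ> f, \<sigma> \<circ> f') \<in> ae_equiv M m" if f': "(f, f') \<in> ae_equiv M n" for f'
  proof -
    have "AE t in M. f t = f' t"
      using f' by (auto simp: ae_equiv_def)
    then have "AE t in M. (\<sigma> \<circ> f) t = (\<sigma> \<circ> f') t"
      by eventually_elim simp
    then show ?thesis
      using f' \<sigma> comp_measurable_mor[of f M n \<sigma> m] comp_measurable_mor[of f' M n \<sigma> m]
      by (auto simp: ae_equiv_def)
  qed
  have "Nabla_map M n m \<sigma> (ae_equiv M n `` {f}) =
      (\<Union>f'\<in>ae_equiv M n `` {f}. ae_equiv M m `` {\<sigma> \<circ> f'})"
    by (auto simp: Nabla_map_def)
  also have "\<dots> = ae_equiv M m `` {\<sigma> \<circ> f}"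
  proof (rule UN_constant_eq)
    show "f \<in> ae_equiv M n `` {f}"
      by (rule equiv_class_self[OF equiv_ae_equiv f])
    show "\<forall>f'\<in>ae_equiv M n `` {f}. ae_equiv M m `` {\<sigma> \<circ> f'} = ae_equiv M m `` {\<sigma> \<circ> f}"
      using equiv_class_eq[OF equiv_ae_equiv *] by blast
  qed
  finally show ?thesis .
qed

context prob_space
begin

lemma prob_law_in_standard_simplex:
  assumes "U \<in> nabla_points M n"
  shows "prob_law M U \<in> standard_simplex n"
proof -
  obtain f where f: "f \<in> M \<rightarrow>\<^sub>M count_space {..n}" and U: "U = ae_equiv M n `` {f}"
    using assms by (rule nabla_points_cases)
  have bound: "f t \<le> n" if "t \<in> space M" for t
    using measurable_space[OF f that] by simp
  have "f -` {i} \<inter> space M = {}" if "i > n" for i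
    using bound that by fastforce
  moreover have "(\<Sum>i\<le>n. prob (f -` {i} \<inter> space M)) = prob (\<Union>i\<le>n. f -` {i} \<inter> space M)"
    using f by (intro finite_measure_finite_Union[symmetric])
      (auto simp: disjoint_family_on_def intro: measurable_vimage_set)
  moreover have "(\<Union>i\<le>n. f -` {i} \<inter> space M) = space M"
    using bound by auto
  ultimately show ?thesis
    using f by (simp add: U prob_law_class standard_simplex_def prob_space)
qed

lemma prob_law_natural:
  assumes \<sigma>: "\<sigma> \<in> mor n m" and "U \<in> nabla_points M n"
  shows "prob_law M (Nabla_map M n m \<sigma> U) = Delta_map n m \<sigma> (prob_law M U)"
proof -
  obtain f where f: "f \<in> M \<rightarrow>\<^sub>M count_space {..n}" and U: "U = ae_equiv M n `` {f}"
    using assms(2) by (rule nabla_points_cases)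
  have bound: "f t \<le> n" if "t \<in> space M" for t
    using measurable_space[OF f that] by simp
  have "prob ((\<sigma> \<circ> f) -` {i} \<inter> space M) =
      (\<Sum>j | j \<le> n \<and> \<sigma> j = i. prob (f -` {j} \<inter> space M))" for i
  proof -
    have "(\<sigma> \<circ> f) -` {i} \<inter> space M = (\<Union>j\<in>{j. j \<le> n \<and> \<sigma> j = i}. f -` {j} \<inter> space M)"
      using bound by auto
    also have "prob \<dots> = (\<Sum>j\<in>{j. j \<le> n \<and> \<sigma> j = i}. prob (f -` {j} \<inter> space M))"
      using f by (intro finite_measure_finite_Union)
        (auto simp: disjoint_family_on_def intro: measurable_vimage_set)
    finally show ?thesis .
  qed
  then show ?thesis
    using f \<sigma> by (simp add: U Nabla_map_class prob_law_class comp_measurable_mor Delta_map_def)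
qed

lemma law_map_class:
  assumes \<alpha>: "\<alpha> \<in> F n" and U: "U \<in> nabla_points M n"
  shows "law_map M F act (glue_equiv F act (Nabla M) (Nabla_map M) `` {(n, \<alpha>, U)}) =
    glue_equiv F act Delta Delta_map `` {(n, \<alpha>, prob_law M U)}"
proof -
  define P where "P = (\<lambda>(n :: nat, \<alpha> :: 'b, a). (n, \<alpha>, prob_law M a))"
  let ?E = "glue_equiv F act (Nabla M) (Nabla_map M)"
  let ?D = "glue_equiv F act Delta Delta_map"
  have glue: "glue F act Delta Delta_map (P z) (P w)"
    if zw: "glue F act (Nabla M) (Nabla_map M) z w" for z w
  proof -
    obtain n m \<sigma> \<alpha> a where "\<sigma> \<in> mor n m" "\<alpha> \<in> F m" "a \<in> nabla_points M n"
      "z = (n, act n m \<sigma> \<alpha>, a)" "w = (m, \<alpha>, Nabla_map M n m \<sigma> a)"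
      using zw by (auto simp: glue_def)
    moreover from this have "prob_law M a \<in> topspace (Delta n)"
      by (simp add: Delta_def prob_law_in_standard_simplex)
    ultimately show ?thesis
      unfolding glue_def P_def
      by (intro exI[of _ n] exI[of _ m] exI[of _ \<sigma>] exI[of _ \<alpha>] exI[of _ "prob_law M a"])
        (simp add: prob_law_natural)
  qed
  have equivclp: "equivclp (glue F act Delta Delta_map) (P z) (P w)"
    if "equivclp (glue F act (Nabla M) (Nabla_map M)) z w" for z w
    using that
  proof (induction rule: equivclp_induct)
    case (step y w)
    then have "equivclp (glue F act Delta Delta_map) (P y) (P w)"
      by (meson glue r_into_equivclp converse_r_into_equivclp)
    with step show ?case
      by (meson equivclp_trans)
  qed simp
  have "P z \<in> topspace (total_space F Delta)" if "z \<in> topspace (total_space F (Nabla M))" for z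
    using that by (auto simp: P_def total_space_def Delta_def prob_law_in_standard_simplex)
  then have rel: "(P z, P w) \<in> ?D" if "(z, w) \<in> ?E" for z w
    using that equivclp by (auto simp: glue_equiv_def generated_equiv_def)
  have D: "equiv (topspace (total_space F Delta)) ?D"
    and E: "equiv (topspace (total_space F (Nabla M))) ?E"
    by (simp_all add: glue_equiv_def equiv_generated_equiv)
  let ?z = "(n, \<alpha>, U)"
  have "?z \<in> topspace (total_space F (Nabla M))"
    using \<alpha> U by (simp add: total_space_def)
  then have self: "?z \<in> ?E `` {?z}"
    by (rule equiv_class_self[OF E])
  have "law_map M F act (?E `` {?z}) = (\<Union>w\<in>?E `` {?z}. ?D `` {P w})"
    unfolding law_map_def P_def by blast
  also have "\<dots> = ?D `` {P ?z}"
    using equiv_class_eq[OF D rel, of ?z] by (intro UN_constant_eq[OF self]) blast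
  finally have "law_map M F act (?E `` {?z}) = ?D `` {P ?z}" .
  then show ?thesis
    by (simp add: P_def)
qed

end

end

theory Submission
  imports Defs
begin

text \<open>
  Atomlessness enters through one fact: there is a family of events \<open>A t\<close>, increasing in \<open>t\<close>, with
  \<open>prob (A t) = t\<close> for \<open>0 \<le> t \<le> 1\<close> (\<open>atomless_event_chain\<close>). It is read off from a maximal chain of
  events with distinct probabilities, which Zorn's lemma provides.

  The family yields a section of the law: the point \<open>x\<close> of the simplex goes to the random variable
  with value \<open>i\<close> on \<open>A (x\<^sub>0 + \<dots> + x\<^sub>i) - A (x\<^sub>0 + \<dots> + x\<^sub>i\<^sub>-\<^sub>1)\<close>. It is natural with respect to
  increasing injections (\<open>quantile_natural\<close>). The homotopy from the identity to the law
  followed by this section replaces \<open>f\<close>, at time \<open>t\<close>, by the section of its law on \<open>A t\<close>, and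
  keeps \<open>f\<close> elsewhere. A change of time from \<open>t\<close> to \<open>s\<close> affects the result only on a set
  of measure at most \<open>\<bar>s - t\<bar>\<close>, so the homotopy is continuous (\<open>law_homotopy_dist\<close>), and it is
  visibly natural (\<open>law_homotopy_natural\<close>). Natural maps and natural homotopies descend to
  realizations, the latter because the product of a quotient map with the unit interval is a
  quotient map (\<open>realization_lift\<close>, \<open>realization_lift_prod\<close>). So the induced maps of realizations
  are inverse to each other up to homotopy.

  It remains to see that the geometric realization is a CW complex
  (\<open>cw_complex_geometric_realization\<close>). A function on the simplex of \<open>\<alpha>\<close> that
  vanishes on the boundary extends to a continuous function on the whole realization, which on another
  simplex sums the values over all faces equal to \<open>\<alpha>\<close>. These functions separate points that are
  represented in the interior of simplices (\<open>interior_point_unique\<close>), and every point is. This gives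
  at once the Hausdorff property, the disjointness of the open cells, and the injectivity of the
  characteristic maps on the open discs. Closed discs are identified with simplices by
  radial projection from the barycenter (\<open>closed_disc_homeomorphic_simplex\<close>); compactness then
  makes the characteristic maps closed, hence embeddings on the open discs.
\<close>

section \<open>A measurable chain realizing every probability\<close>

text \<open>A family of events which is totally ordered by inclusion, and in which distinct events have
  distinct probabilities. The second condition makes the order of the events the order of their
  probabilities, which is what the maximality argument below needs: without it, null sets would
  interfere.\<close>

definition (in prob_space) event_chain :: "'a set set \<Rightarrow> bool" where
  "event_chain \<C> \<longleftrightarrow> \<C> \<subseteq> events \<and>
     (\<forall>A\<in>\<C>. \<forall>B\<in>\<C>. (A \<subseteq> B \<or> B \<subseteq> A) \<and> (prob A = prob B \<longrightarrow> A = B))"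

context prob_space
begin

lemma event_chain_subset_iff:
  assumes "event_chain \<C>" "A \<in> \<C>" "B \<in> \<C>"
  shows "A \<subseteq> B \<longleftrightarrow> prob A \<le> prob B"
  using assms unfolding event_chain_def
  by (metis antisym finite_measure_mono order_refl subset_iff)

lemma event_chain_insert:
  assumes "event_chain \<C>" "W \<in> events" "\<And>D. D \<in> \<C> \<Longrightarrow> D \<subseteq> W \<or> W \<subseteq> D"
    and "\<And>D. D \<in> \<C> \<Longrightarrow> prob D \<noteq> prob W"
  shows "event_chain (insert W \<C>)"
  using assms unfolding event_chain_def by (auto simp: eq_commute)

lemma maximal_event_chain_exists:
  "\<exists>\<C>. event_chain \<C> \<and> {} \<in> \<C> \<and> space M \<in> \<C> \<and>
     (\<forall>\<D>. event_chain \<D> \<longrightarrow> \<C> \<subseteq> \<D> \<longrightarrow> \<D> = \<C>)"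
proof -
  define \<A> where "\<A> = {\<C>. event_chain \<C> \<and> {} \<in> \<C> \<and> space M \<in> \<C>}"
  have "\<exists>\<C>\<in>\<A>. \<forall>\<D>\<in>\<A>. \<C> \<subseteq> \<D> \<longrightarrow> \<D> = \<C>"
  proof (rule subset_Zorn_nonempty)
    have "{{}, space M} \<in> \<A>"
      by (auto simp: \<A>_def event_chain_def prob_space)
    then show "\<A> \<noteq> {}" by blast
    fix K assume K: "K \<noteq> {}" "subset.chain \<A> K"
    have sub: "K \<subseteq> \<A>" and tot: "\<And>X Y. X \<in> K \<Longrightarrow> Y \<in> K \<Longrightarrow> X \<subseteq> Y \<or> Y \<subseteq> X"
      using K(2) by (auto simp: subset_chain_def)
    have "(A \<subseteq> B \<or> B \<subseteq> A) \<and> (prob A = prob B \<longrightarrow> A = B)" if AB: "A \<in> \<Union>K" "B \<in> \<Union>K" for A B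
    proof -
      obtain X Y where "X \<in> K" "A \<in> X" "Y \<in> K" "B \<in> Y"
        using AB by blast
      with tot[of X Y] obtain Z where "Z \<in> K" "A \<in> Z" "B \<in> Z"
        by blast
      then show ?thesis
        using sub by (auto simp: \<A>_def event_chain_def)
    qed
    then show "\<Union>K \<in> \<A>"
      using sub K(1) unfolding \<A>_def event_chain_def by blast
  qed
  then show ?thesis
    unfolding \<A>_def by blast
qed

text \<open>Among the members of a maximal chain with probability less than a missing value \<open>c\<close> there is
  a largest one: otherwise the union of countably many of them, with probabilities tending to the
  supremum, could be added to the chain.
  The statement about infima follows by taking complements.\<close>

lemma event_chain_Sup_attained:
  assumes \<C>: "event_chain \<C>" and max: "\<And>\<D>. event_chain \<D> \<Longrightarrow> \<C> \<subseteq> \<D> \<Longrightarrow> \<D> = \<C>"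
    and empty: "{} \<in> \<C>" and c: "c > 0" "\<And>D. D \<in> \<C> \<Longrightarrow> prob D \<noteq> c"
  shows "\<exists>U\<in>\<C>. prob U < c \<and> (\<forall>D\<in>\<C>. prob D < c \<longrightarrow> D \<subseteq> U)"
proof (rule ccontr)
  assume neg: "\<not> ?thesis"
  define S where "S = {D \<in> \<C>. prob D < c}"
  define a where "a = Sup (prob ` S)"
  have S: "prob ` S \<noteq> {}" "bdd_above (prob ` S)"
    using empty c by (auto simp: S_def intro!: bdd_aboveI[of _ 1])
  have le_a: "prob D \<le> a" if "D \<in> S" for D
    unfolding a_def using that S by (intro cSup_upper) auto
  have "a \<le> c"
    unfolding a_def using S by (intro cSup_least) (auto simp: S_def less_imp_le)
  have less_a: "prob D < a" if "D \<in> S" for D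
  proof (rule ccontr)
    assume "\<not> prob D < a"
    then have "\<forall>D'\<in>S. D' \<subseteq> D"
      using le_a[OF that] le_a event_chain_subset_iff[OF \<C>] that by (force simp: S_def)
    then show False
      using neg that unfolding S_def by blast
  qed
  have "\<exists>D\<in>S. a - 1 / Suc n < prob D" for n :: nat
    using less_cSupD[OF S(1), of "a - 1 / Suc n"] by (auto simp: a_def)
  then obtain C where C: "\<And>n. C n \<in> S" "\<And>n. a - 1 / Suc n < prob (C n)"
    by metis
  define U where "U = (\<Union>n. C n)"
  have Cev: "C n \<in> events" for n
    using C(1) \<C> by (auto simp: S_def event_chain_def)
  have below: "D \<subseteq> U" if D: "D \<in> S" for D
  proof -
    obtain n where "1 / Suc n < a - prob D"
    proof (rule nat_approx_posE)
      show "0 < a - prob D" using less_a[OF D] by simp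
    qed
    with C(2)[of n] have "prob D \<le> prob (C n)"
      by linarith
    then show ?thesis
      using event_chain_subset_iff[OF \<C>, of D "C n"] C(1)[of n] D by (auto simp: S_def U_def)
  qed
  have above: "U \<subseteq> D" if "D \<in> \<C>" "D \<notin> S" for D
  proof -
    have "prob (C n) \<le> prob D" for n
      using C(1)[of n] that by (auto simp: S_def)
    then show ?thesis
      using event_chain_subset_iff[OF \<C>] C(1) that by (force simp: S_def U_def)
  qed
  have U: "U \<in> events"
    unfolding U_def using Cev by blast
  have "prob U \<ge> a"
  proof (rule field_le_epsilon)
    fix e :: real assume "e > 0"
    then obtain n where "1 / Suc n < e"
      using nat_approx_posE by blast
    with C(2)[of n] have "a \<le> prob (C n) + e"
      by linarith
    also have "\<dots> \<le> prob U + e"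
      using U by (auto intro!: finite_measure_mono simp: U_def)
    finally show "a \<le> prob U + e" .
  qed
  \<comment> \<open>A finite union of members of a chain is one of them.\<close>
  have fin: "\<exists>D\<in>S. (\<Union>i\<le>n. C i) = D" for n
  proof (induction n)
    case 0
    then show ?case using C(1)[of 0] by auto
  next
    case (Suc n)
    then obtain D where D: "D \<in> S" "(\<Union>i\<le>n. C i) = D" by blast
    then have "(\<Union>i\<le>Suc n. C i) = D \<union> C (Suc n)"
      by (auto simp: atMost_Suc)
    moreover have "D \<subseteq> C (Suc n) \<or> C (Suc n) \<subseteq> D"
      using D(1) C(1)[of "Suc n"] \<C> by (auto simp: S_def event_chain_def)
    ultimately show ?case
      using D(1) C(1)[of "Suc n"] by (metis sup.absorb1 sup.absorb2)
  qed
  have "(\<lambda>n. prob (\<Union>i\<le>n. C i)) \<longlonglongrightarrow> prob (\<Union>n. \<Union>i\<le>n. C i)"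
    using Cev by (intro finite_Lim_measure_incseq) (auto simp: incseq_def intro: order_trans)
  moreover have "(\<Union>n. \<Union>i\<le>n. C i) = U"
    by (auto simp: U_def)
  moreover have "prob (\<Union>i\<le>n. C i) \<le> a" for n
    using fin[of n] le_a by blast
  ultimately have "prob U \<le> a"
    using LIMSEQ_le_const2 by blast
  with \<open>prob U \<ge> a\<close> have Ua: "prob U = a" by simp
  have "prob D \<noteq> prob U" if "D \<in> \<C>" for D
  proof (cases "D \<in> S")
    case True
    then show ?thesis using less_a Ua by force
  next
    case False
    then have "prob D > c"
      using that c(2)[OF that] by (auto simp: S_def)
    then show ?thesis
      using Ua \<open>a \<le> c\<close> by simp
  qed
  moreover have "D \<subseteq> U \<or> U \<subseteq> D" if "D \<in> \<C>" for D
    using below above that by blast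
  ultimately have "event_chain (insert U \<C>)"
    by (intro event_chain_insert[OF \<C> U]) auto
  then have "U \<in> \<C>"
    using max by blast
  then show False
    using \<open>\<And>D. D \<in> \<C> \<Longrightarrow> prob D \<noteq> prob U\<close> by blast
qed

lemma event_chain_compl:
  assumes "event_chain \<C>"
  shows "event_chain ((\<lambda>A. space M - A) ` \<C>)"
  unfolding event_chain_def
proof (intro conjI ballI)
  show "(\<lambda>A. space M - A) ` \<C> \<subseteq> events"
    using assms by (auto simp: event_chain_def)
next
  fix A B assume "A \<in> (\<lambda>A. space M - A) ` \<C>" "B \<in> (\<lambda>A. space M - A) ` \<C>"
  then obtain A' B' where AB: "A' \<in> \<C>" "A = space M - A'" "B' \<in> \<C>" "B = space M - B'"
    by blast
  then have ev: "A' \<in> events" "B' \<in> events"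
    using assms by (auto simp: event_chain_def)
  show "A \<subseteq> B \<or> B \<subseteq> A"
    using AB assms by (auto simp: event_chain_def)
  show "prob A = prob B \<longrightarrow> A = B"
    using AB assms ev by (auto simp: event_chain_def prob_compl)
qed

lemma event_chain_compl_compl:
  assumes "event_chain \<C>"
  shows "(\<lambda>A. space M - A) ` (\<lambda>A. space M - A) ` \<C> = \<C>"
proof -
  have "(\<lambda>A. space M - A) ` (\<lambda>A. space M - A) ` \<C> = (\<lambda>A. A) ` \<C>"
    unfolding image_image using assms sets.sets_into_space
    by (intro image_cong refl double_diff[OF _ subset_refl]) (auto simp: event_chain_def)
  then show ?thesis by simp
qed

lemma event_chain_Inf_attained:
  assumes \<C>: "event_chain \<C>" and max: "\<And>\<D>. event_chain \<D> \<Longrightarrow> \<C> \<subseteq> \<D> \<Longrightarrow> \<D> = \<C>"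
    and full: "space M \<in> \<C>" and c: "c < 1" "\<And>D. D \<in> \<C> \<Longrightarrow> prob D \<noteq> c"
  shows "\<exists>V\<in>\<C>. c < prob V \<and> (\<forall>D\<in>\<C>. c < prob D \<longrightarrow> V \<subseteq> D)"
proof -
  let ?N = "\<lambda>A. space M - A"
  have ev: "D \<in> events" if "D \<in> \<C>" for D
    using \<C> that by (auto simp: event_chain_def)
  have "\<exists>U\<in>?N ` \<C>. prob U < 1 - c \<and> (\<forall>D\<in>?N ` \<C>. prob D < 1 - c \<longrightarrow> D \<subseteq> U)"
  proof (rule event_chain_Sup_attained)
    show "event_chain (?N ` \<C>)"
      by (rule event_chain_compl[OF \<C>])
    show "{} \<in> ?N ` \<C>"
      using full by (auto intro!: image_eqI[of _ _ "space M"])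
    show "prob D \<noteq> 1 - c" if "D \<in> ?N ` \<C>" for D
      using that c ev by (auto simp: prob_compl)
    fix \<D> assume \<D>: "event_chain \<D>" "?N ` \<C> \<subseteq> \<D>"
    then have "?N ` ?N ` \<C> \<subseteq> ?N ` \<D>"
      by (rule_tac image_mono)
    then have "?N ` \<D> = \<C>"
      using max[OF event_chain_compl[OF \<D>(1)]] event_chain_compl_compl[OF \<C>] by simp
    then show "\<D> = ?N ` \<C>"
      using event_chain_compl_compl[OF \<D>(1)] by simp
  qed (use c in auto)
  then obtain V where V: "V \<in> \<C>" "prob (?N V) < 1 - c"
    and le: "\<And>D. D \<in> \<C> \<Longrightarrow> prob (?N D) < 1 - c \<Longrightarrow> ?N D \<subseteq> ?N V"
    by blast
  have "V \<subseteq> D" if D: "D \<in> \<C>" "c < prob D" for D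
  proof -
    have "?N D \<subseteq> ?N V"
      using le D ev by (auto simp: prob_compl)
    then show ?thesis
      using ev[OF V(1)] ev[OF D(1)] sets.sets_into_space by blast
  qed
  then show ?thesis
    using V ev by (auto simp: prob_compl)
qed

text \<open>In a maximal chain of events of an atomless space no probability is left out: a missing value
  lies in a gap between two successive members, and atomlessness provides an event that can be
  inserted there.\<close>

proposition atomless_event_chain:
  assumes "atomless M"
  obtains A :: "real \<Rightarrow> 'a set"
  where "\<And>t. A t \<in> events" "mono A" "\<And>t. t \<le> 0 \<Longrightarrow> A t = {}" "\<And>t. t \<ge> 1 \<Longrightarrow> A t = space M"
    "\<And>t. 0 \<le> t \<Longrightarrow> t \<le> 1 \<Longrightarrow> prob (A t) = t"
proof -
  obtain \<C> where \<C>: "event_chain \<C>" and empty: "{} \<in> \<C>" and full: "space M \<in> \<C>"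
    and max: "\<And>\<D>. event_chain \<D> \<Longrightarrow> \<C> \<subseteq> \<D> \<Longrightarrow> \<D> = \<C>"
    using maximal_event_chain_exists by blast
  have "\<exists>D\<in>\<C>. prob D = c" if c: "0 \<le> c" "c \<le> 1" for c
  proof (rule ccontr)
    assume "\<not> ?thesis"
    then have ne: "\<And>D. D \<in> \<C> \<Longrightarrow> prob D \<noteq> c" by blast
    with empty full c have "0 < c" "c < 1"
      using prob_space by (force simp: less_le)+
    then obtain U V where U: "U \<in> \<C>" "prob U < c" "\<And>D. D \<in> \<C> \<Longrightarrow> prob D < c \<Longrightarrow> D \<subseteq> U"
      and V: "V \<in> \<C>" "c < prob V" "\<And>D. D \<in> \<C> \<Longrightarrow> c < prob D \<Longrightarrow> V \<subseteq> D"
      using event_chain_Sup_attained[OF \<C> max empty _ ne]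
        event_chain_Inf_attained[OF \<C> max full _ ne] by metis
    have ev: "U \<in> events" "V \<in> events"
      using \<C> U V by (auto simp: event_chain_def)
    have "U \<subseteq> V"
      using event_chain_subset_iff[OF \<C> U(1) V(1)] U V by simp
    then have "prob (V - U) > 0"
      using finite_measure_Diff[OF ev(2,1)] U V by simp
    then obtain B where B: "B \<in> events" "B \<subseteq> V - U" "0 < prob B" "prob B < prob (V - U)"
      using assms ev unfolding atomless_def emeasure_eq_measure
      by (metis ennreal_less_iff ennreal_eq_0_iff measure_nonneg not_less sets.Diff zero_less_iff_neq_zero)
    have W: "prob (U \<union> B) = prob U + prob B"
      using B ev by (intro finite_measure_Union) auto
    have "event_chain (insert (U \<union> B) \<C>)"
    proof (rule event_chain_insert[OF \<C>])
      fix D assume D: "D \<in> \<C>"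
      have *: "D \<subseteq> U \<or> V \<subseteq> D"
        using U(3)[OF D] V(3)[OF D] ne[OF D] by linarith
      then show "D \<subseteq> U \<union> B \<or> U \<union> B \<subseteq> D"
        using B \<open>U \<subseteq> V\<close> by blast
      have "prob D \<le> prob U \<or> prob V \<le> prob D"
        using * ev D \<C> by (auto intro: finite_measure_mono simp: event_chain_def)
      then show "prob D \<noteq> prob (U \<union> B)"
        using B finite_measure_Diff[OF ev(2,1) \<open>U \<subseteq> V\<close>] W by auto
    qed (use ev B in auto)
    then have "U \<union> B \<in> \<C>"
      using max by blast
    moreover have "prob U < prob (U \<union> B)" "prob (U \<union> B) < prob V"
      using B finite_measure_Diff[OF ev(2,1) \<open>U \<subseteq> V\<close>] W by auto
    ultimately show False
      using U(3) V(3) ne[of "U \<union> B"] ev finite_measure_mono[of "U \<union> B" U]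
        finite_measure_mono[of V "U \<union> B"] B(1) by (meson linorder_neqE not_less sets.Un)
  qed
  then obtain D where D: "\<And>c. 0 \<le> c \<Longrightarrow> c \<le> 1 \<Longrightarrow> D c \<in> \<C> \<and> prob (D c) = c"
    by metis
  have ev: "C \<in> events" if "C \<in> \<C>" for C
    using \<C> that by (auto simp: event_chain_def)
  define A where "A t = (if t \<le> 0 then {} else if t \<ge> 1 then space M else D t)" for t
  show ?thesis
  proof (rule that[of A])
    show events: "A t \<in> events" for t
      using D[of t] ev by (auto simp: A_def)
    show "mono A"
    proof (rule monoI)
      fix s t :: real assume "s \<le> t"
      then show "A s \<subseteq> A t"
        using D[of s] D[of t] event_chain_subset_iff[OF \<C>, of "D s" "D t"] sets.sets_into_space[OF ev, of "D s"]
        by (auto simp: A_def)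
    qed
    show "prob (A t) = t" if "0 \<le> t" "t \<le> 1" for t
      using D[of t] that prob_space by (auto simp: A_def)
  qed (auto simp: A_def)
qed

end

section \<open>Maps out of realizations\<close>

text \<open>The point of the realization that is represented by \<open>z\<close>.\<close>

abbreviation realization_class where
  "realization_class F act T G z \<equiv> glue_equiv F act T G `` {z}"

lemma topspace_total_space:
  "topspace (total_space F T) = {(n, \<alpha>, a). \<alpha> \<in> F n \<and> a \<in> topspace (T n)}"
  by (auto simp: total_space_def)

lemma quotient_map_realization:
  "quotient_map (total_space F T) (realization F act T G) (realization_class F act T G)"
  unfolding realization_def by (rule quotient_map_quotient_topology)

lemma topspace_realization:
  "topspace (realization F act T G) =
     {realization_class F act T G (n, \<alpha>, a) | n \<alpha> a. \<alpha> \<in> F n \<and> a \<in> topspace (T n)}"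
proof -
  have "topspace (realization F act T G) =
      realization_class F act T G ` {(n, \<alpha>, a). \<alpha> \<in> F n \<and> a \<in> topspace (T n)}"
    using quotient_imp_surjective_map[OF quotient_map_realization[of F T act G]]
    by (simp add: topspace_total_space)
  also have "\<dots> = {realization_class F act T G (n, \<alpha>, a) | n \<alpha> a. \<alpha> \<in> F n \<and> a \<in> topspace (T n)}"
    by (auto simp: image_def)
  finally show ?thesis .
qed

lemma realization_class_eq:
  assumes "\<sigma> \<in> mor n m" "\<alpha> \<in> F m" "a \<in> topspace (T n)"
    and "act n m \<sigma> \<alpha> \<in> F n" "G n m \<sigma> a \<in> topspace (T m)"
  shows "realization_class F act T G (n, act n m \<sigma> \<alpha>, a) =
    realization_class F act T G (m, \<alpha>, G n m \<sigma> a)"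
proof -
  have "glue F act T G (n, act n m \<sigma> \<alpha>, a) (m, \<alpha>, G n m \<sigma> a)"
    using assms unfolding glue_def by blast
  then have "((n, act n m \<sigma> \<alpha>, a), (m, \<alpha>, G n m \<sigma> a)) \<in> glue_equiv F act T G"
    using assms
    by (auto simp: glue_equiv_def generated_equiv_def topspace_total_space intro: r_into_equivclp)
  then show ?thesis
    unfolding glue_equiv_def by (rule equiv_class_eq[OF equiv_generated_equiv])
qed

text \<open>A function that respects the gluing is constant on equivalence classes.\<close>

lemma realization_class_eqD:
  assumes "realization_class F act T G z = realization_class F act T G w"
    and "w \<in> topspace (total_space F T)"
    and glue: "\<And>n m \<sigma> \<alpha> a. \<lbrakk>\<sigma> \<in> mor n m; \<alpha> \<in> F m; a \<in> topspace (T n)\<rbrakk> \<Longrightarrow>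
      h (n, act n m \<sigma> \<alpha>, a) = h (m, \<alpha>, G n m \<sigma> a)"
  shows "h z = h w"
proof -
  have "w \<in> realization_class F act T G w"
    using assms(2) by (simp add: glue_equiv_def generated_equiv_def)
  then have "equivclp (glue F act T G) z w"
    unfolding assms(1)[symmetric] by (simp add: glue_equiv_def generated_equiv_def)
  then show ?thesis
  proof (induction rule: equivclp_induct)
    case (step y w)
    then show ?case
      by (auto simp: glue_def glue)
  qed simp
qed

text \<open>A total space is the disjoint union of its open pieces \<open>{(n, \<alpha>)} \<times> T n\<close>.\<close>

lemma continuous_map_prod_total_space:
  fixes F :: "nat \<Rightarrow> 'a set" and T :: "nat \<Rightarrow> 'b topology"
  assumes "\<And>n \<alpha>. \<alpha> \<in> F n \<Longrightarrow> continuous_map (prod_topology Z (T n)) Y (\<lambda>(z, a). h (z, n, \<alpha>, a))"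
  shows "continuous_map (prod_topology Z (total_space F T)) Y h"
proof -
  define I where "I = {(n, \<alpha>). \<alpha> \<in> F n}"
  define Q where "Q = (\<lambda>(n :: nat, \<alpha> :: 'a). topspace Z \<times> ({n} \<times> {\<alpha>} \<times> topspace (T n)))"
  define k where "k = (\<lambda>(n :: nat, \<alpha> :: 'a) (z, w :: nat \<times> 'a \<times> 'b). h (z, n, \<alpha>, snd (snd w)))"
  have op: "openin (total_space F T) ({n} \<times> {\<alpha>} \<times> U)" if "\<alpha> \<in> F n" "openin (T n) U" for n \<alpha> U
    unfolding total_space_def openin_sum_topology
  proof (intro conjI ballI)
    show "{n} \<times> {\<alpha>} \<times> U \<subseteq> Sigma UNIV (topspace \<circ> (\<lambda>n. prod_topology (discrete_topology (F n)) (T n)))"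
      using that openin_subset[OF that(2)] by auto
    show "openin (prod_topology (discrete_topology (F i)) (T i)) {x. (i, x) \<in> {n} \<times> {\<alpha>} \<times> U}" for i
      using that by (cases "i = n") (simp_all add: openin_prod_Times_iff)
  qed
  show ?thesis
  proof (rule pasting_lemma[where I = I and T = Q and f = k])
    fix i assume "i \<in> I"
    then obtain n \<alpha> where i: "i = (n, \<alpha>)" "\<alpha> \<in> F n"
      by (auto simp: I_def)
    then show "openin (prod_topology Z (total_space F T)) (Q i)"
      by (auto simp: Q_def openin_prod_Times_iff op)
    have snd: "continuous_map (subtopology (total_space F T) ({n} \<times> {\<alpha>} \<times> topspace (T n))) (T n)
      (\<lambda>w. snd (snd w))"
      unfolding continuous_map_def
    proof (intro conjI allI impI)
      fix U assume U: "openin (T n) U"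
      let ?P = "{n} \<times> {\<alpha>} \<times> topspace (T n)"
      have "{w \<in> topspace (subtopology (total_space F T) ?P). snd (snd w) \<in> U} = {n} \<times> {\<alpha>} \<times> U"
        using i(2) openin_subset[OF U] by (auto simp: topspace_total_space)
      then show "openin (subtopology (total_space F T) ?P)
          {w \<in> topspace (subtopology (total_space F T) ?P). snd (snd w) \<in> U}"
        using op[OF i(2) U] openin_subset[OF U] by (auto simp: openin_subtopology_alt)
    qed auto
    have "continuous_map (prod_topology Z (subtopology (total_space F T) ({n} \<times> {\<alpha>} \<times> topspace (T n))))
        (prod_topology Z (T n)) (\<lambda>(z, w). (z, snd (snd w)))"
      using continuous_map_prod_top[of Z "subtopology (total_space F T) ({n} \<times> {\<alpha>} \<times> topspace (T n))"
        Z "T n" "\<lambda>z. z" "\<lambda>w. snd (snd w)"] snd by simp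
    from continuous_map_compose[OF this assms[OF i(2)]]
    have "continuous_map (prod_topology Z (subtopology (total_space F T) ({n} \<times> {\<alpha>} \<times> topspace (T n)))) Y (k i)"
      by (simp add: i k_def o_def case_prod_unfold)
    moreover have "subtopology (prod_topology Z (total_space F T)) (Q i) =
        prod_topology Z (subtopology (total_space F T) ({n} \<times> {\<alpha>} \<times> topspace (T n)))"
      unfolding i Q_def prod.case subtopology_Times subtopology_topspace by (rule refl)
    ultimately show "continuous_map (subtopology (prod_topology Z (total_space F T)) (Q i)) Y (k i)"
      by simp
  qed (auto simp: I_def Q_def k_def topspace_total_space)
qed

lemma continuous_map_total_space:
  assumes "\<And>n \<alpha>. \<alpha> \<in> F n \<Longrightarrow> continuous_map (T n) Y (\<lambda>a. h (n, \<alpha>, a))"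
  shows "continuous_map (total_space F T) Y h"
proof -
  have "continuous_map (prod_topology (discrete_topology {()}) (total_space F T)) Y (h \<circ> snd)"
  proof (rule continuous_map_prod_total_space)
    fix n \<alpha> assume "\<alpha> \<in> F n"
    from continuous_map_compose[OF continuous_map_snd assms[OF this]]
    show "continuous_map (prod_topology (discrete_topology {()}) (T n)) Y
        (\<lambda>(z, a). (h \<circ> snd) (z, n, \<alpha>, a))"
      by (simp add: o_def case_prod_unfold)
  qed
  moreover have "continuous_map (total_space F T)
      (prod_topology (discrete_topology {()}) (total_space F T)) (\<lambda>w. ((), w))"
    by (simp add: continuous_map_paired)
  ultimately have "continuous_map (total_space F T) Y ((h \<circ> snd) \<circ> (\<lambda>w. ((), w)))"
    using continuous_map_compose by blast
  then show ?thesis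
    by (simp add: o_def)
qed

lemma continuous_map_realization_class:
  assumes "\<alpha> \<in> F n"
  shows "continuous_map (T n) (realization F act T G) (\<lambda>a. realization_class F act T G (n, \<alpha>, a))"
proof -
  have "continuous_map (T n) (total_space F T) (\<lambda>a. (n, \<alpha>, a))"
  proof -
    have "continuous_map (T n) (prod_topology (discrete_topology (F n)) (T n)) (\<lambda>a. (\<alpha>, a))"
      using assms by (simp add: continuous_map_paired)
    from continuous_map_compose[OF this
        continuous_map_component_injection[of n UNIV "\<lambda>n. prod_topology (discrete_topology (F n)) (T n)"]]
    show ?thesis
      by (simp add: o_def total_space_def)
  qed
  from continuous_map_compose[OF this quotient_imp_continuous_map[OF quotient_map_realization]]
  show ?thesis
    by (simp add: o_def)
qed

text \<open>Maps out of a realization, and more generally maps depending on a parameter in a locally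
  compact space \<open>Z\<close>, are the families of maps on the pieces that respect the gluing. Local
  compactness makes the product of \<open>Z\<close> with the quotient map a quotient map.\<close>

proposition realization_lift_prod:
  assumes Z: "locally_compact_space Z" "Hausdorff_space Z"
    and cont: "\<And>n \<alpha>. \<alpha> \<in> F n \<Longrightarrow> continuous_map (prod_topology Z (T n)) Y (\<lambda>(z, a). h z (n, \<alpha>, a))"
    and glue: "\<And>z n m \<sigma> \<alpha> a. \<lbrakk>z \<in> topspace Z; \<sigma> \<in> mor n m; \<alpha> \<in> F m; a \<in> topspace (T n)\<rbrakk> \<Longrightarrow>
      h z (n, act n m \<sigma> \<alpha>, a) = h z (m, \<alpha>, G n m \<sigma> a)"
  obtains H where "continuous_map (prod_topology Z (realization F act T G)) Y H"
    "\<And>z n \<alpha> a. \<lbrakk>z \<in> topspace Z; \<alpha> \<in> F n; a \<in> topspace (T n)\<rbrakk> \<Longrightarrow>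
      H (z, realization_class F act T G (n, \<alpha>, a)) = h z (n, \<alpha>, a)"
proof -
  let ?q = "realization_class F act T G"
  have q: "quotient_map (prod_topology Z (total_space F T)) (prod_topology Z (realization F act T G))
      (\<lambda>(z, w). (z, ?q w))"
    by (rule quotient_map_prod_right) (use Z quotient_map_realization in auto)
  have c: "continuous_map (prod_topology Z (total_space F T)) Y (\<lambda>(z, w). h z w)"
    using cont by (intro continuous_map_prod_total_space) simp
  have e: "(\<lambda>(z, w). h z w) x = (\<lambda>(z, w). h z w) y"
    if x: "x \<in> topspace (prod_topology Z (total_space F T))"
      and y: "y \<in> topspace (prod_topology Z (total_space F T))"
      and eq: "(\<lambda>(z, w). (z, ?q w)) x = (\<lambda>(z, w). (z, ?q w)) y" for x y
  proof -
    obtain z w w' where xy: "x = (z, w)" "y = (z, w')" "?q w = ?q w'" "z \<in> topspace Z"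
      "w' \<in> topspace (total_space F T)"
      using x y eq by (cases x, cases y) auto
    then have "h z w = h z w'"
      using glue by (intro realization_class_eqD[of F act T G w w' "h z"]) auto
    then show ?thesis
      by (simp add: xy)
  qed
  obtain H where H: "continuous_map (prod_topology Z (realization F act T G)) Y H"
    "\<And>x. x \<in> topspace (prod_topology Z (total_space F T)) \<Longrightarrow>
       H ((\<lambda>(z, w). (z, ?q w)) x) = (\<lambda>(z, w). h z w) x"
  proof (rule quotient_map_lift_exists[OF q c])
    fix x y assume "x \<in> topspace (prod_topology Z (total_space F T))"
      "y \<in> topspace (prod_topology Z (total_space F T))"
      "(\<lambda>(z, w). (z, ?q w)) x = (\<lambda>(z, w). (z, ?q w)) y"
    then show "(\<lambda>(z, w). h z w) x = (\<lambda>(z, w). h z w) y"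
      by (rule e)
  qed (rule that)
  show ?thesis
  proof (rule that[OF H(1)])
    show "H (z, ?q (n, \<alpha>, a)) = h z (n, \<alpha>, a)"
      if "z \<in> topspace Z" "\<alpha> \<in> F n" "a \<in> topspace (T n)" for z n \<alpha> a
      using H(2)[of "(z, n, \<alpha>, a)"] that by (simp add: topspace_total_space)
  qed
qed

proposition realization_lift:
  assumes cont: "\<And>n \<alpha>. \<alpha> \<in> F n \<Longrightarrow> continuous_map (T n) Y (\<lambda>a. h (n, \<alpha>, a))"
    and glue: "\<And>n m \<sigma> \<alpha> a. \<lbrakk>\<sigma> \<in> mor n m; \<alpha> \<in> F m; a \<in> topspace (T n)\<rbrakk> \<Longrightarrow>
      h (n, act n m \<sigma> \<alpha>, a) = h (m, \<alpha>, G n m \<sigma> a)"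
  obtains H where "continuous_map (realization F act T G) Y H"
    "\<And>n \<alpha> a. \<lbrakk>\<alpha> \<in> F n; a \<in> topspace (T n)\<rbrakk> \<Longrightarrow>
      H (realization_class F act T G (n, \<alpha>, a)) = h (n, \<alpha>, a)"
proof -
  obtain H where "continuous_map (realization F act T G) Y H"
    "\<And>x. x \<in> topspace (total_space F T) \<Longrightarrow> H (realization_class F act T G x) = h x"
  proof (rule quotient_map_lift_exists[OF quotient_map_realization[of F T act G], of Y h])
    show "continuous_map (total_space F T) Y h"
      using cont by (rule continuous_map_total_space)
    show "h x = h y" if "x \<in> topspace (total_space F T)" "y \<in> topspace (total_space F T)"
      "realization_class F act T G x = realization_class F act T G y" for x y
      using that(3,2) glue by (rule realization_class_eqD)
  qed (rule that)
  then show ?thesis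
    by (intro that[of H]) (auto simp: topspace_total_space)
qed

lemma closedin_realization:
  "closedin (realization F act T G) C \<longleftrightarrow> C \<subseteq> topspace (realization F act T G) \<and>
     (\<forall>n. \<forall>\<alpha>\<in>F n. closedin (T n) {a \<in> topspace (T n). realization_class F act T G (n, \<alpha>, a) \<in> C})"
  (is "?lhs \<longleftrightarrow> ?rhs")
proof
  assume ?lhs
  show ?rhs
  proof (intro conjI allI ballI)
    fix n \<alpha> assume "\<alpha> \<in> F n"
    from closedin_continuous_map_preimage[OF continuous_map_realization_class[of \<alpha> F n T act G, OF this] \<open>?lhs\<close>]
    show "closedin (T n) {a \<in> topspace (T n). realization_class F act T G (n, \<alpha>, a) \<in> C}" .
  qed (rule closedin_subset[OF \<open>?lhs\<close>])
next
  assume R: ?rhs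
  let ?q = "realization_class F act T G"
  have "openin (total_space F T) {w \<in> topspace (total_space F T). ?q w \<notin> C}"
    unfolding total_space_def openin_sum_topology
  proof (intro conjI ballI)
    fix n
    have eq: "{x. (n, x) \<in> {w \<in> topspace (sum_topology (\<lambda>n. prod_topology (discrete_topology (F n)) (T n)) UNIV). ?q w \<notin> C}}
       = (\<Union>\<alpha>\<in>F n. {\<alpha>} \<times> (topspace (T n) - {a \<in> topspace (T n). ?q (n, \<alpha>, a) \<in> C}))"
      by auto
    show "openin (prod_topology (discrete_topology (F n)) (T n)) {x. (n, x) \<in> {w \<in> topspace (sum_topology (\<lambda>n. prod_topology (discrete_topology (F n)) (T n)) UNIV). ?q w \<notin> C}}"
      unfolding eq
    proof (rule openin_Union, elim imageE, hypsubst)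
      fix \<alpha> assume "\<alpha> \<in> F n"
      then have "openin (T n) (topspace (T n) - {a \<in> topspace (T n). ?q (n, \<alpha>, a) \<in> C})"
        using R by blast
      with \<open>\<alpha> \<in> F n\<close>
      show "openin (prod_topology (discrete_topology (F n)) (T n))
          ({\<alpha>} \<times> (topspace (T n) - {a \<in> topspace (T n). ?q (n, \<alpha>, a) \<in> C}))"
        by (simp add: openin_prod_Times_iff)
    qed
  qed auto
  then have "closedin (total_space F T)
      (topspace (total_space F T) - {w \<in> topspace (total_space F T). ?q w \<notin> C})"
    by (rule closedin_diff[OF closedin_topspace])
  also have "topspace (total_space F T) - {w \<in> topspace (total_space F T). ?q w \<notin> C} =
      {w \<in> topspace (total_space F T). ?q w \<in> C}" by auto
  finally show ?lhs
    using R quotient_map_realization[of F T act G] by (simp add: quotient_map_closedin)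
qed

section \<open>Standard simplices\<close>

lemma standard_simplexD:
  assumes "x \<in> standard_simplex n"
  shows "0 \<le> x i" "x i \<le> 1" "n < i \<Longrightarrow> x i = 0" "(\<Sum>i\<le>n. x i) = 1"
    "0 \<le> (\<Sum>j<i. x j)" "(\<Sum>j<i. x j) \<le> 1"
proof -
  show *: "0 \<le> x i" "x i \<le> 1" "n < i \<Longrightarrow> x i = 0" "(\<Sum>i\<le>n. x i) = 1" for i
    using assms by (auto simp: standard_simplex_def)
  show "0 \<le> (\<Sum>j<i. x j)"
    using * by (simp add: sum_nonneg)
  have "(\<Sum>j<i. x j) = (\<Sum>j\<in>{..<i} \<inter> {..n}. x j)"
    using * by (intro sum.mono_neutral_right) (auto intro: leI)
  also have "\<dots> \<le> (\<Sum>j\<le>n. x j)"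
    using * by (intro sum_mono2) auto
  finally show "(\<Sum>j<i. x j) \<le> 1"
    using * by simp
qed

lemma topspace_Delta: "topspace (Delta n) = standard_simplex n"
  by (simp add: Delta_def)

lemma continuous_map_Delta_component: "continuous_map (Delta n) euclideanreal (\<lambda>x. x i)"
  unfolding Delta_def
  by (intro continuous_map_from_subtopology continuous_map_product_projection) simp

lemma Delta_map_in_standard_simplex:
  assumes \<sigma>: "\<sigma> \<in> mor n m" and x: "x \<in> standard_simplex n"
  shows "Delta_map n m \<sigma> x \<in> standard_simplex m"
proof -
  have "Delta_map n m \<sigma> x i = 0" if "i > m" for i
  proof -
    have "{j. j \<le> n \<and> \<sigma> j = i} = {}"
      using mor_imp_le[OF \<sigma>] that by fastforce
    then show ?thesis
      by (simp only: Delta_map_def sum.empty)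
  qed
  moreover have "0 \<le> Delta_map n m \<sigma> x i" for i
    unfolding Delta_map_def using standard_simplexD(1)[OF x] by (intro sum_nonneg)
  moreover have "Delta_map n m \<sigma> x i \<le> 1" for i
  proof -
    have "Delta_map n m \<sigma> x i \<le> (\<Sum>j\<le>n. x j)"
      unfolding Delta_map_def using standard_simplexD(1)[OF x] by (intro sum_mono2) auto
    then show ?thesis
      using standard_simplexD(4)[OF x] by simp
  qed
  moreover have "(\<Sum>i\<le>m. Delta_map n m \<sigma> x i) = 1"
  proof -
    have "(\<Sum>i\<le>m. Delta_map n m \<sigma> x i) = (\<Sum>i\<le>m. \<Sum>j | j \<in> {..n} \<and> \<sigma> j = i. x j)"
      by (simp add: Delta_map_def)
    also have "\<dots> = (\<Sum>j\<le>n. x j)"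
      using mor_imp_le[OF \<sigma>] by (intro sum.group) auto
    finally show ?thesis
      using standard_simplexD(4)[OF x] by simp
  qed
  ultimately show ?thesis
    by (simp add: standard_simplex_def)
qed

section \<open>A natural section of the law and a natural homotopy\<close>

text \<open>A map to a metric space is continuous if the distances \<open>d (f x) (f y)\<close> are dominated by
  continuous functions of \<open>y\<close> that vanish at \<open>x\<close>.\<close>

lemma (in Metric_space) continuous_map_to_metric_bound:
  assumes f: "\<And>x. x \<in> topspace X \<Longrightarrow> f x \<in> M"
    and \<phi>: "\<And>x. x \<in> topspace X \<Longrightarrow> continuous_map X euclideanreal (\<phi> x)"
      "\<And>x. x \<in> topspace X \<Longrightarrow> \<phi> x x = 0"
    and le: "\<And>x y. \<lbrakk>x \<in> topspace X; y \<in> topspace X\<rbrakk> \<Longrightarrow> d (f x) (f y) \<le> \<phi> x y"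
  shows "continuous_map X mtopology f"
  unfolding continuous_map_to_metric
proof (intro ballI allI impI)
  fix x and e :: real assume x: "x \<in> topspace X" and e: "e > 0"
  have "openin X {y \<in> topspace X. \<phi> x y \<in> {..<e}}"
    using \<phi>(1)[OF x] by (rule openin_continuous_map_preimage) simp
  moreover have "f y \<in> mball (f x) e" if "y \<in> topspace X" "\<phi> x y < e" for y
    using le[OF x that(1)] that f x by simp
  ultimately show "\<exists>U. openin X U \<and> x \<in> U \<and> (\<forall>y\<in>U. f y \<in> mball (f x) e)"
    using x e \<phi>(2)[OF x] by (intro exI[of _ "{y \<in> topspace X. \<phi> x y \<in> {..<e}}"]) auto
qed

text \<open>The data of \<open>atomless_event_chain\<close>: the event \<open>A t\<close> plays the role of \<open>[0, t]\<close> for a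
  uniformly distributed random variable. Outside of \<open>0 < t < 1\<close> the events are prescribed exactly
  and not only up to null sets, so that identities between random variables hold at every point.\<close>

locale prob_chain = prob_space M for M :: "'w measure" +
  fixes A :: "real \<Rightarrow> 'w set"
  assumes chain_events: "\<And>t. A t \<in> events" and chain_mono: "mono A"
    and chain_empty: "\<And>t. t \<le> 0 \<Longrightarrow> A t = {}"
    and chain_space: "\<And>t. t \<ge> 1 \<Longrightarrow> A t = space M"
    and chain_prob: "\<And>t. 0 \<le> t \<Longrightarrow> t \<le> 1 \<Longrightarrow> prob (A t) = t"
begin

text \<open>The random variable with law \<open>x\<close> that takes its values in increasing order along the chain.\<close>

definition quantile :: "(nat \<Rightarrow> real) \<Rightarrow> 'w \<Rightarrow> nat" where
  "quantile x \<omega> = (LEAST i. \<omega> \<in> A (\<Sum>j\<le>i. x j))"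

lemma quantile_less_iff:
  assumes x: "x \<in> standard_simplex n" and \<omega>: "\<omega> \<in> space M"
  shows "quantile x \<omega> < i \<longleftrightarrow> \<omega> \<in> A (\<Sum>j<i. x j)"
proof
  assume less: "quantile x \<omega> < i"
  have "\<omega> \<in> A (\<Sum>j\<le>n. x j)"
    using x \<omega> by (simp add: standard_simplexD chain_space)
  then have "\<omega> \<in> A (\<Sum>j\<le>quantile x \<omega>. x j)"
    unfolding quantile_def by (rule LeastI)
  moreover have "(\<Sum>j\<le>quantile x \<omega>. x j) \<le> (\<Sum>j<i. x j)"
    using less standard_simplexD(1)[OF x] by (intro sum_mono2) auto
  ultimately show "\<omega> \<in> A (\<Sum>j<i. x j)"
    using monoD[OF chain_mono] by blast
next
  assume *: "\<omega> \<in> A (\<Sum>j<i. x j)"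
  then obtain k where "i = Suc k"
    using chain_empty[of 0] by (cases i) auto
  then show "quantile x \<omega> < i"
    using * Least_le[of "\<lambda>i. \<omega> \<in> A (\<Sum>j\<le>i. x j)" k]
    by (auto simp: quantile_def lessThan_Suc_atMost less_Suc_eq_le)
qed

lemma quantile_le:
  assumes "x \<in> standard_simplex n" "\<omega> \<in> space M"
  shows "quantile x \<omega> \<le> n"
  using quantile_less_iff[OF assms, of "Suc n"] assms
  by (simp add: lessThan_Suc_atMost standard_simplexD chain_space)

lemma quantile_vimage:
  assumes "x \<in> standard_simplex n"
  shows "quantile x -` {i} \<inter> space M = A (\<Sum>j<Suc i. x j) - A (\<Sum>j<i. x j)"
proof -
  have "quantile x \<omega> = i \<longleftrightarrow> quantile x \<omega> < Suc i \<and> \<not> quantile x \<omega> < i" for \<omega>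
    by auto
  then show ?thesis
    using quantile_less_iff[OF assms] sets.sets_into_space[OF chain_events] by blast
qed

lemma measurable_quantile:
  assumes "x \<in> standard_simplex n"
  shows "quantile x \<in> M \<rightarrow>\<^sub>M count_space {..n}"
  using quantile_le[OF assms] quantile_vimage[OF assms] chain_events
  by (auto simp: measurable_count_space_eq2 simp del: sum.lessThan_Suc)

lemma prob_quantile:
  assumes x: "x \<in> standard_simplex n"
  shows "prob (quantile x -` {i} \<inter> space M) = x i"
proof -
  have "A (\<Sum>j<i. x j) \<subseteq> A (\<Sum>j<Suc i. x j)"
    using standard_simplexD(1)[OF x] by (intro monoD[OF chain_mono]) simp
  then have "prob (quantile x -` {i} \<inter> space M) = (\<Sum>j<Suc i. x j) - (\<Sum>j<i. x j)"
    using standard_simplexD(5,6)[OF x]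
    by (simp add: quantile_vimage[OF x] finite_measure_Diff chain_events chain_prob del: sum.lessThan_Suc)
  then show ?thesis by simp
qed

text \<open>Naturality holds because \<open>\<sigma>\<close> preserves the order of the values, and the values that it
  omits have probability zero.\<close>

lemma quantile_natural:
  assumes \<sigma>: "\<sigma> \<in> mor n m" and x: "x \<in> standard_simplex n"
    and y: "Delta_map n m \<sigma> x \<in> standard_simplex m" and \<omega>: "\<omega> \<in> space M"
  shows "quantile (Delta_map n m \<sigma> x) \<omega> = \<sigma> (quantile x \<omega>)"
proof -
  have "quantile (Delta_map n m \<sigma> x) \<omega> < k \<longleftrightarrow> \<sigma> (quantile x \<omega>) < k" for k
  proof -
    define p where "p = (LEAST i. \<not> (i \<le> n \<and> \<sigma> i < k))"
    have "\<exists>i. \<not> (i \<le> n \<and> \<sigma> i < k)"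
      by (intro exI[of _ "Suc n"]) simp
    then have p: "\<not> (p \<le> n \<and> \<sigma> p < k)"
      unfolding p_def by (rule LeastI_ex)
    have mono: "\<sigma> i \<le> \<sigma> j" if "i \<le> j" "j \<le> n" for i j
      using \<sigma> that by (cases "i = j") (auto simp: mor_def dest: strict_mono_onD[of _ _ i j])
    \<comment> \<open>The indices mapped below \<open>k\<close> form an initial segment.\<close>
    have seg: "i \<le> n \<and> \<sigma> i < k \<longleftrightarrow> i < p" for i
    proof
      show "i \<le> n \<and> \<sigma> i < k" if "i < p"
        using not_less_Least[of i "\<lambda>i. \<not> (i \<le> n \<and> \<sigma> i < k)"] that by (auto simp: p_def)
      show "i < p" if "i \<le> n \<and> \<sigma> i < k"
        using p mono[of p i] that by (meson le_less_trans not_less order_trans)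
    qed
    have "(\<Sum>j<k. Delta_map n m \<sigma> x j) = (\<Sum>j<k. \<Sum>i\<in>{i \<in> {i. i \<le> n \<and> \<sigma> i < k}. \<sigma> i = j}. x i)"
      unfolding Delta_map_def by (intro sum.cong) auto
    also have "\<dots> = (\<Sum>i | i \<le> n \<and> \<sigma> i < k. x i)"
      by (intro sum.group) auto
    also have "{i. i \<le> n \<and> \<sigma> i < k} = {..<p}"
      using seg by auto
    finally have "quantile (Delta_map n m \<sigma> x) \<omega> < k \<longleftrightarrow> quantile x \<omega> < p"
      using quantile_less_iff[OF y \<omega>] quantile_less_iff[OF x \<omega>] by simp
    also have "\<dots> \<longleftrightarrow> \<sigma> (quantile x \<omega>) < k"
      using seg[of "quantile x \<omega>"] quantile_le[OF x \<omega>] by simp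
    finally show ?thesis .
  qed
  then show ?thesis
    by (metis linorder_neqE_nat less_irrefl)
qed

lemma quantile_continuity:
  assumes x: "x \<in> standard_simplex n" and y: "y \<in> standard_simplex n"
  shows "prob {\<omega> \<in> space M. quantile x \<omega> \<noteq> quantile y \<omega>} \<le>
    (\<Sum>i\<le>n. \<bar>(\<Sum>j<i. x j) - (\<Sum>j<i. y j)\<bar>)"
proof -
  have diff: "prob ((A s - A t) \<union> (A t - A s)) \<le> \<bar>s - t\<bar>" if "0 \<le> s" "s \<le> 1" "0 \<le> t" "t \<le> 1" for s t
  proof -
    have *: "prob ((A s - A t) \<union> (A t - A s)) \<le> t - s" if "0 \<le> s" "s \<le> t" "t \<le> 1" for s t
    proof -
      have "A s \<subseteq> A t"
        using chain_mono that by (auto dest: monoD)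
      then have "(A s - A t) \<union> (A t - A s) = A t - A s" by blast
      then show ?thesis
        using \<open>A s \<subseteq> A t\<close> that by (simp add: finite_measure_Diff chain_events chain_prob)
    qed
    show ?thesis
      using *[of s t] *[of t s] that by (cases "s \<le> t") (auto simp: Un_commute)
  qed
  let ?D = "\<lambda>i. (A (\<Sum>j<i. x j) - A (\<Sum>j<i. y j)) \<union> (A (\<Sum>j<i. y j) - A (\<Sum>j<i. x j))"
  have "{\<omega> \<in> space M. quantile x \<omega> \<noteq> quantile y \<omega>} \<subseteq> (\<Union>i\<in>{..n}. ?D i)"
  proof clarify
    fix \<omega> assume \<omega>: "\<omega> \<in> space M" and ne: "quantile x \<omega> \<noteq> quantile y \<omega>"
    have le: "quantile x \<omega> \<le> n" "quantile y \<omega> \<le> n"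
      using x y \<omega> by (auto intro: quantile_le)
    define i where "i = max (quantile x \<omega>) (quantile y \<omega>)"
    have "i \<le> n" "(quantile x \<omega> < i) \<noteq> (quantile y \<omega> < i)"
      using ne le by (auto simp: i_def max_def)
    then show "\<omega> \<in> (\<Union>i\<in>{..n}. ?D i)"
      using quantile_less_iff[OF x \<omega>, of i] quantile_less_iff[OF y \<omega>, of i] by blast
  qed
  then have "prob {\<omega> \<in> space M. quantile x \<omega> \<noteq> quantile y \<omega>} \<le> prob (\<Union>i\<in>{..n}. ?D i)"
    using chain_events by (intro finite_measure_mono) auto
  also have "\<dots> \<le> (\<Sum>i\<le>n. prob (?D i))"
    using chain_events by (intro finite_measure_subadditive_finite) auto
  also have "\<dots> \<le> (\<Sum>i\<le>n. \<bar>(\<Sum>j<i. x j) - (\<Sum>j<i. y j)\<bar>)"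
    using standard_simplexD(5,6)[OF x] standard_simplexD(5,6)[OF y] by (intro sum_mono diff)
  finally show ?thesis .
qed

text \<open>The class modulo almost everywhere equality of the random variable above.\<close>

definition law_section :: "nat \<Rightarrow> (nat \<Rightarrow> real) \<Rightarrow> ('w \<Rightarrow> nat) set" where
  "law_section n x = ae_equiv M n `` {quantile x}"

lemma class_in_nabla_points:
  "f \<in> M \<rightarrow>\<^sub>M count_space {..n} \<Longrightarrow> ae_equiv M n `` {f} \<in> nabla_points M n"
  by (simp add: nabla_points_def quotientI)

lemma class_eqI:
  assumes "f \<in> M \<rightarrow>\<^sub>M count_space {..n}" "g \<in> M \<rightarrow>\<^sub>M count_space {..n}"
    "\<And>\<omega>. \<omega> \<in> space M \<Longrightarrow> f \<omega> = g \<omega>"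
  shows "ae_equiv M n `` {f} = ae_equiv M n `` {g}"
  using assms by (intro equiv_class_eq[OF equiv_ae_equiv]) (auto simp: ae_equiv_def)

lemma law_section_in:
  "x \<in> standard_simplex n \<Longrightarrow> law_section n x \<in> nabla_points M n"
  by (simp add: law_section_def class_in_nabla_points measurable_quantile)

lemma prob_law_section:
  "x \<in> standard_simplex n \<Longrightarrow> prob_law M (law_section n x) = x"
  by (simp add: law_section_def prob_law_class measurable_quantile prob_quantile)

lemma law_section_natural:
  assumes \<sigma>: "\<sigma> \<in> mor n m" and x: "x \<in> standard_simplex n"
    and y: "Delta_map n m \<sigma> x \<in> standard_simplex m"
  shows "law_section m (Delta_map n m \<sigma> x) = Nabla_map M n m \<sigma> (law_section n x)"
  unfolding law_section_def Nabla_map_class[OF measurable_quantile[OF x] \<sigma>]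
  by (intro class_eqI measurable_quantile[OF y] comp_measurable_mor[OF measurable_quantile[OF x] \<sigma>])
    (simp add: quantile_natural[OF \<sigma> x y])

lemma continuous_map_law_section: "continuous_map (Delta n) (Nabla M n) (law_section n)"
  unfolding Nabla_def
proof (rule Metric_space.continuous_map_to_metric_bound[OF Metric_space_nabla])
  fix x assume x: "x \<in> topspace (Delta n)"
  show "continuous_map (Delta n) euclideanreal
      (\<lambda>y. \<Sum>i\<le>n. \<bar>(\<Sum>j<i. x j) - (\<Sum>j<i. y j)\<bar>)"
    by (intro continuous_intros continuous_map_sum continuous_map_Delta_component) auto
  fix y assume y: "y \<in> topspace (Delta n)"
  show "nabla_dist M n (law_section n x) (law_section n y) \<le> (\<Sum>i\<le>n. \<bar>(\<Sum>j<i. x j) - (\<Sum>j<i. y j)\<bar>)"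
    using x y by (simp add: topspace_Delta law_section_def nabla_dist_class measurable_quantile
        quantile_continuity)
qed (auto simp: topspace_Delta law_section_in)

lemma prob_law_continuity:
  assumes "U \<in> nabla_points M n" "V \<in> nabla_points M n"
  shows "\<bar>prob_law M U i - prob_law M V i\<bar> \<le> nabla_dist M n U V"
proof -
  have *: "prob_law M U i \<le> prob_law M V i + nabla_dist M n U V"
    if "U \<in> nabla_points M n" "V \<in> nabla_points M n" for U V
  proof -
    obtain f g where f: "f \<in> M \<rightarrow>\<^sub>M count_space {..n}" "U = ae_equiv M n `` {f}"
      and g: "g \<in> M \<rightarrow>\<^sub>M count_space {..n}" "V = ae_equiv M n `` {g}"
      using \<open>U \<in> nabla_points M n\<close> \<open>V \<in> nabla_points M n\<close> by (elim nabla_points_cases)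
    have "prob (f -` {i} \<inter> space M) \<le> prob ((g -` {i} \<inter> space M) \<union> {t \<in> space M. f t \<noteq> g t})"
      using f g by (intro finite_measure_mono) (auto intro!: sets.Un measurable_neq_set measurable_vimage_set)
    also have "\<dots> \<le> prob (g -` {i} \<inter> space M) + prob {t \<in> space M. f t \<noteq> g t}"
      using f g by (intro measure_Un_le measurable_neq_set measurable_vimage_set)
    finally show ?thesis
      using f g by (simp add: prob_law_class nabla_dist_class)
  qed
  have "nabla_dist M n V U = nabla_dist M n U V"
    using Metric_space.commute[OF Metric_space_nabla] .
  then show ?thesis
    using *[OF assms] *[OF assms(2,1)] by linarith
qed

lemma continuous_map_nabla_dist:
  assumes "U \<in> nabla_points M n" "continuous_map X (Nabla M n) f"
  shows "continuous_map X euclideanreal (\<lambda>x. nabla_dist M n U (f x))"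
  unfolding mtopology_is_euclidean[symmetric] Met_TC.continuous_map_to_metric
proof (intro ballI allI impI)
  interpret N: Metric_space "nabla_points M n" "nabla_dist M n"
    by (rule Metric_space_nabla)
  fix x and e :: real assume x: "x \<in> topspace X" and e: "e > 0"
  have f: "f y \<in> nabla_points M n" if "y \<in> topspace X" for y
    using continuous_map_image_subset_topspace[OF assms(2)] that by auto
  have "openin X {y \<in> topspace X. f y \<in> N.mball (f x) e}"
    using assms(2) by (rule openin_continuous_map_preimage) (simp add: Nabla_def)
  moreover have "\<bar>nabla_dist M n U (f x) - nabla_dist M n U (f y)\<bar> < e"
    if y: "y \<in> topspace X" "f y \<in> N.mball (f x) e" for y
    using N.triangle[OF assms(1) f[OF x] f[OF y(1)]] N.triangle[OF assms(1) f[OF y(1)] f[OF x]]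
      N.commute[of "f x" "f y"] y(2) by (simp add: abs_less_iff)
  ultimately show "\<exists>W. openin X W \<and> x \<in> W \<and>
      (\<forall>y\<in>W. nabla_dist M n U (f y) \<in> Met_TC.mball (nabla_dist M n U (f x)) e)"
    using x e f by (intro exI[of _ "{y \<in> topspace X. f y \<in> N.mball (f x) e}"])
      (auto simp: dist_real_def)
qed

lemma continuous_map_prob_law: "continuous_map (Nabla M n) (Delta n) (prob_law M)"
  unfolding Delta_def continuous_map_in_subtopology continuous_map_componentwise_UNIV
proof (intro conjI allI)
  fix i
  show "continuous_map (Nabla M n) euclideanreal (\<lambda>U. prob_law M U i)"
    unfolding mtopology_is_euclidean[symmetric]
  proof (rule Met_TC.continuous_map_to_metric_bound[where \<phi> = "nabla_dist M n"])
    fix U assume U: "U \<in> topspace (Nabla M n)"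
    then show "continuous_map (Nabla M n) euclideanreal (nabla_dist M n U)"
      using continuous_map_nabla_dist[of U n "Nabla M n" "\<lambda>V. V"] by simp
    show "dist (prob_law M U i) (prob_law M V i) \<le> nabla_dist M n U V" if "V \<in> topspace (Nabla M n)" for V
      using prob_law_continuity[of U n V i] U that by (simp add: dist_real_def)
  qed (auto simp: Metric_space.mdist_zero[OF Metric_space_nabla])
qed (auto simp: prob_law_in_standard_simplex)

text \<open>The homotopy replaces a random variable by the normal form of its law on the growing events
  \<open>A t\<close>. It commutes with \<open>\<sigma> \<circ> _\<close> because both random variables that are pieced together do.
  The definition on a class takes all representatives; they give the same result
  (\<open>law_homotopy_class\<close>).\<close>

definition law_homotopy :: "nat \<Rightarrow> real \<Rightarrow> ('w \<Rightarrow> nat) set \<Rightarrow> ('w \<Rightarrow> nat) set" where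
  "law_homotopy n t U =
     ae_equiv M n `` ((\<lambda>f \<omega>. if \<omega> \<in> A t then quantile (prob_law M U) \<omega> else f \<omega>) ` U)"

lemma measurable_mix:
  assumes "f \<in> M \<rightarrow>\<^sub>M count_space {..n}" "g \<in> M \<rightarrow>\<^sub>M count_space {..n}"
  shows "(\<lambda>\<omega>. if \<omega> \<in> A t then g \<omega> else f \<omega>) \<in> M \<rightarrow>\<^sub>M count_space {..n}"
  using assms chain_events by (intro measurable_If) (auto simp: sets.sets_into_space Int_absorb1)

lemma law_homotopy_class:
  assumes f: "f \<in> M \<rightarrow>\<^sub>M count_space {..n}" and U: "U = ae_equiv M n `` {f}"
  shows "law_homotopy n t U =
    ae_equiv M n `` {\<lambda>\<omega>. if \<omega> \<in> A t then quantile (prob_law M U) \<omega> else f \<omega>}"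
proof -
  let ?h = "\<lambda>f \<omega>. if \<omega> \<in> A t then quantile (prob_law M U) \<omega> else f \<omega>"
  have q: "quantile (prob_law M U) \<in> M \<rightarrow>\<^sub>M count_space {..n}"
    unfolding U by (intro measurable_quantile prob_law_in_standard_simplex class_in_nabla_points f)
  have rel: "(?h f, ?h f') \<in> ae_equiv M n" if "f' \<in> U" for f'
  proof -
    have "f' \<in> M \<rightarrow>\<^sub>M count_space {..n}" "AE \<omega> in M. f \<omega> = f' \<omega>"
      using that by (auto simp: U ae_equiv_def)
    moreover from this(2) have "AE \<omega> in M. ?h f \<omega> = ?h f' \<omega>"
      by eventually_elim simp
    ultimately show ?thesis
      using measurable_mix[OF f q, of t] measurable_mix[OF \<open>f' \<in> M \<rightarrow>\<^sub>M count_space {..n}\<close> q, of t]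
      by (simp add: ae_equiv_def)
  qed
  have *: "ae_equiv M n `` {?h f'} = ae_equiv M n `` {?h f}" if "f' \<in> U" for f'
    by (rule equiv_class_eq[OF equiv_ae_equiv rel[OF that], symmetric])
  have "f \<in> U"
    unfolding U by (rule equiv_class_self[OF equiv_ae_equiv f])
  have "law_homotopy n t U = (\<Union>f'\<in>U. ae_equiv M n `` {?h f'})"
    by (auto simp: law_homotopy_def)
  also have "\<dots> = ae_equiv M n `` {?h f}"
    by (rule UN_constant_eq[OF \<open>f \<in> U\<close>]) (rule ballI, rule *)
  finally show ?thesis .
qed

lemma law_homotopy_in:
  assumes "U \<in> nabla_points M n"
  shows "law_homotopy n t U \<in> nabla_points M n"
proof -
  obtain f where "f \<in> M \<rightarrow>\<^sub>M count_space {..n}" "U = ae_equiv M n `` {f}"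
    using assms by (rule nabla_points_cases)
  then show ?thesis
    using assms by (simp only: law_homotopy_class)
      (intro class_in_nabla_points measurable_mix measurable_quantile prob_law_in_standard_simplex)
qed

lemma law_homotopy_0:
  assumes "U \<in> nabla_points M n"
  shows "law_homotopy n 0 U = U"
proof -
  obtain f where "f \<in> M \<rightarrow>\<^sub>M count_space {..n}" "U = ae_equiv M n `` {f}"
    using assms by (rule nabla_points_cases)
  then show ?thesis
    by (simp add: law_homotopy_class chain_empty)
qed

lemma law_homotopy_1:
  assumes "U \<in> nabla_points M n"
  shows "law_homotopy n 1 U = law_section n (prob_law M U)"
proof -
  obtain f where f: "f \<in> M \<rightarrow>\<^sub>M count_space {..n}" "U = ae_equiv M n `` {f}"
    using assms by (rule nabla_points_cases)
  have q: "quantile (prob_law M U) \<in> M \<rightarrow>\<^sub>M count_space {..n}"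
    by (intro measurable_quantile prob_law_in_standard_simplex assms)
  show ?thesis
    unfolding law_homotopy_class[OF f] law_section_def
    using measurable_mix[OF f(1) q, of 1] q by (intro class_eqI) (auto simp: chain_space)
qed

lemma Nabla_map_in:
  assumes "\<sigma> \<in> mor n m" "U \<in> nabla_points M n"
  shows "Nabla_map M n m \<sigma> U \<in> nabla_points M m"
proof -
  obtain f where f: "f \<in> M \<rightarrow>\<^sub>M count_space {..n}" "U = ae_equiv M n `` {f}"
    using assms(2) by (rule nabla_points_cases)
  then show ?thesis
    using assms(1) by (simp add: Nabla_map_class class_in_nabla_points comp_measurable_mor)
qed

lemma law_homotopy_natural:
  assumes \<sigma>: "\<sigma> \<in> mor n m" and U: "U \<in> nabla_points M n"
  shows "law_homotopy m t (Nabla_map M n m \<sigma> U) = Nabla_map M n m \<sigma> (law_homotopy n t U)"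
proof -
  obtain f where f: "f \<in> M \<rightarrow>\<^sub>M count_space {..n}" "U = ae_equiv M n `` {f}"
    using U by (rule nabla_points_cases)
  have V: "Nabla_map M n m \<sigma> U = ae_equiv M m `` {\<sigma> \<circ> f}"
    unfolding f(2) by (rule Nabla_map_class[OF f(1) \<sigma>])
  have x: "prob_law M U \<in> standard_simplex n"
    by (intro prob_law_in_standard_simplex U)
  have y: "Delta_map n m \<sigma> (prob_law M U) \<in> standard_simplex m"
    unfolding prob_law_natural[OF \<sigma> U, symmetric]
    by (intro prob_law_in_standard_simplex Nabla_map_in \<sigma> U)
  note mix = measurable_mix[OF f(1) measurable_quantile[OF x], of t]
  show ?thesis
    unfolding law_homotopy_class[OF comp_measurable_mor[OF f(1) \<sigma>] V] law_homotopy_class[OF f]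
      Nabla_map_class[OF mix \<sigma>] prob_law_natural[OF \<sigma> U]
    by (intro class_eqI measurable_mix comp_measurable_mor[OF f(1) \<sigma>] measurable_quantile[OF y]
        comp_measurable_mor[OF mix \<sigma>])
      (use quantile_natural[OF \<sigma> x y] in auto)
qed

lemma law_homotopy_dist:
  assumes st: "0 \<le> s" "s \<le> 1" "0 \<le> t" "t \<le> 1"
    and U: "U \<in> nabla_points M n" and V: "V \<in> nabla_points M n"
  shows "nabla_dist M n (law_homotopy n s U) (law_homotopy n t V) \<le>
    \<bar>s - t\<bar> + nabla_dist M n U V +
    nabla_dist M n (law_section n (prob_law M U)) (law_section n (prob_law M V))"
proof -
  obtain f g where f: "f \<in> M \<rightarrow>\<^sub>M count_space {..n}" "U = ae_equiv M n `` {f}"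
    and g: "g \<in> M \<rightarrow>\<^sub>M count_space {..n}" "V = ae_equiv M n `` {g}"
    using U V by (elim nabla_points_cases)
  define f' g' where "f' = quantile (prob_law M U)" and "g' = quantile (prob_law M V)"
  have m: "f' \<in> M \<rightarrow>\<^sub>M count_space {..n}" "g' \<in> M \<rightarrow>\<^sub>M count_space {..n}"
    unfolding f'_def g'_def by (intro measurable_quantile prob_law_in_standard_simplex U V)+
  define B where "B = A (max s t) - A (min s t)"
  have B: "B \<in> events" "prob B = \<bar>s - t\<bar>"
  proof -
    have "A (min s t) \<subseteq> A (max s t)"
      by (intro monoD[OF chain_mono]) simp
    then show "B \<in> events" "prob B = \<bar>s - t\<bar>"
      using st by (auto simp: B_def chain_events finite_measure_Diff chain_prob)
  qed
  have B': "\<omega> \<in> B" if "\<omega> \<in> A s \<longleftrightarrow> \<omega> \<notin> A t" for \<omega>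
    using that monoD[OF chain_mono, of s t] monoD[OF chain_mono, of t s]
    by (cases "s \<le> t") (auto simp: B_def max_def min_def)
  let ?h = "\<lambda>\<omega>. if \<omega> \<in> A s then f' \<omega> else f \<omega>" and ?k = "\<lambda>\<omega>. if \<omega> \<in> A t then g' \<omega> else g \<omega>"
  let ?P = "{\<omega> \<in> space M. f \<omega> \<noteq> g \<omega>}" and ?Q = "{\<omega> \<in> space M. f' \<omega> \<noteq> g' \<omega>}"
  have ev: "?P \<in> events" "?Q \<in> events"
    using f g m by (auto intro: measurable_neq_set)
  have "prob {\<omega> \<in> space M. ?h \<omega> \<noteq> ?k \<omega>} \<le> prob (B \<union> ?P \<union> ?Q)"
  proof (rule finite_measure_mono)
    show "{\<omega> \<in> space M. ?h \<omega> \<noteq> ?k \<omega>} \<subseteq> B \<union> ?P \<union> ?Q"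
      using B' by (auto split: if_splits)
  qed (use B ev in auto)
  also have "\<dots> \<le> prob (B \<union> ?P) + prob ?Q"
    using B ev by (intro measure_Un_le) auto
  also have "\<dots> \<le> prob B + prob ?P + prob ?Q"
    using B ev by (intro add_right_mono measure_Un_le) auto
  finally show ?thesis
    unfolding law_homotopy_class[OF f] law_homotopy_class[OF g] law_section_def
      f'_def[symmetric] g'_def[symmetric] nabla_dist_class[OF m] B(2)
      nabla_dist_class[OF measurable_mix[OF f(1) m(1)] measurable_mix[OF g(1) m(2)]]
    unfolding f(2) g(2) nabla_dist_class[OF f(1) g(1)] .
qed

lemma continuous_map_law_homotopy:
  "continuous_map (prod_topology (top_of_set {0..1}) (Nabla M n)) (Nabla M n)
     (\<lambda>(t, U). law_homotopy n t U)"
proof -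
  let ?X = "prod_topology (top_of_set {0..1::real}) (Nabla M n)"
  let ?s = "\<lambda>U. law_section n (prob_law M U)"
  have "continuous_map (Nabla M n) (Nabla M n) ?s"
    using continuous_map_compose[OF continuous_map_prob_law continuous_map_law_section]
    by (simp add: o_def)
  from continuous_map_compose[OF continuous_map_snd this]
  have s: "continuous_map ?X (Nabla M n) (\<lambda>p. ?s (snd p))"
    by (simp add: o_def)
  show ?thesis
  proof -
    have "continuous_map ?X (Metric_space.mtopology (nabla_points M n) (nabla_dist M n))
        (\<lambda>(t, U). law_homotopy n t U)"
    proof (rule Metric_space.continuous_map_to_metric_bound[OF Metric_space_nabla])
      fix p assume p: "p \<in> topspace ?X"
      then obtain t U where tU: "p = (t, U)" "0 \<le> t" "t \<le> 1" "U \<in> nabla_points M n"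
        by auto
      show "(case p of (t, U) \<Rightarrow> law_homotopy n t U) \<in> nabla_points M n"
        using tU by (simp add: law_homotopy_in)
      let ?\<phi> = "\<lambda>p p'. \<bar>fst p - fst p'\<bar> + nabla_dist M n (snd p) (snd p') +
        nabla_dist M n (?s (snd p)) (?s (snd p'))"
      have sU: "?s U \<in> nabla_points M n"
        using tU by (simp add: law_section_in prob_law_in_standard_simplex)
      have "continuous_map ?X euclideanreal fst"
        using continuous_map_fst continuous_map_in_subtopology by blast
      then show "continuous_map ?X euclideanreal (?\<phi> p)"
        using tU sU
        by (intro continuous_intros continuous_map_nabla_dist continuous_map_snd s) auto
      show "?\<phi> p p = 0"
        using tU sU Metric_space.mdist_zero[OF Metric_space_nabla] by simp
      fix p' assume "p' \<in> topspace ?X"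
      then obtain t' U' where tU': "p' = (t', U')" "0 \<le> t'" "t' \<le> 1" "U' \<in> nabla_points M n"
        by auto
      show "nabla_dist M n (case p of (t, U) \<Rightarrow> law_homotopy n t U)
          (case p' of (t, U) \<Rightarrow> law_homotopy n t U) \<le> ?\<phi> p p'"
        using law_homotopy_dist[of t t' U n U'] tU tU' by simp
    qed
    then show ?thesis
      by (simp add: Nabla_def)
  qed
qed

theorem homotopy_equivalence_law_map:
  fixes F :: "nat \<Rightarrow> 'b set"
  assumes "pre_simplicial_set F act"
  shows "homotopy_equivalence (random_realization M F act) (geometric_realization F act)
    (law_map M F act)"
proof -
  interpret pre_simplicial_set F act
    by (rule assms)
  let ?L = "random_realization M F act" and ?D = "geometric_realization F act"
  let ?qL = "realization_class F act (Nabla M) (Nabla_map M)"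
  let ?qD = "realization_class F act Delta Delta_map"
  let ?p = "law_map M F act"
  have topL: "topspace ?L = {?qL (n, \<alpha>, U) | n \<alpha> U. \<alpha> \<in> F n \<and> U \<in> nabla_points M n}"
    unfolding random_realization_def topspace_realization by simp
  have topD: "topspace ?D = {?qD (n, \<alpha>, x) | n \<alpha> x. \<alpha> \<in> F n \<and> x \<in> standard_simplex n}"
    unfolding geometric_realization_def topspace_realization topspace_Delta by simp
  have glueL: "?qL (n, act n m \<sigma> \<alpha>, U) = ?qL (m, \<alpha>, Nabla_map M n m \<sigma> U)"
    if "\<sigma> \<in> mor n m" "\<alpha> \<in> F m" "U \<in> nabla_points M n" for n m \<sigma> \<alpha> U
    using that by (intro realization_class_eq) (auto simp: act_closed Nabla_map_in)
  have glueD: "?qD (n, act n m \<sigma> \<alpha>, x) = ?qD (m, \<alpha>, Delta_map n m \<sigma> x)"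
    if "\<sigma> \<in> mor n m" "\<alpha> \<in> F m" "x \<in> standard_simplex n" for n m \<sigma> \<alpha> x
    using that by (intro realization_class_eq)
      (auto simp: act_closed topspace_Delta Delta_map_in_standard_simplex)
  obtain P where P: "continuous_map ?L ?D P"
    "\<And>n \<alpha> U. \<alpha> \<in> F n \<Longrightarrow> U \<in> nabla_points M n \<Longrightarrow> P (?qL (n, \<alpha>, U)) = ?qD (n, \<alpha>, prob_law M U)"
  proof (rule realization_lift[where Y = ?D and F = F and act = act and T = "Nabla M"
        and G = "Nabla_map M" and h = "\<lambda>(n, \<alpha>, U). ?qD (n, \<alpha>, prob_law M U)"])
    fix n \<alpha> assume "\<alpha> \<in> F n"
    from continuous_map_compose[OF continuous_map_prob_law
        continuous_map_realization_class[of \<alpha> F n Delta act Delta_map, OF this]]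
    show "continuous_map (Nabla M n) ?D (\<lambda>U. case (n, \<alpha>, U) of (n, \<alpha>, U) \<Rightarrow> ?qD (n, \<alpha>, prob_law M U))"
      by (simp add: o_def geometric_realization_def)
  next
    fix n m \<sigma> \<alpha> U assume "\<sigma> \<in> mor n m" "\<alpha> \<in> F m" "U \<in> topspace (Nabla M n)"
    then show "(case (n, act n m \<sigma> \<alpha>, U) of (n, \<alpha>, U) \<Rightarrow> ?qD (n, \<alpha>, prob_law M U)) =
        (case (m, \<alpha>, Nabla_map M n m \<sigma> U) of (n, \<alpha>, U) \<Rightarrow> ?qD (n, \<alpha>, prob_law M U))"
      by (simp add: glueD prob_law_natural prob_law_in_standard_simplex)
  qed (auto simp: random_realization_def)
  have p: "?p (?qL (n, \<alpha>, U)) = ?qD (n, \<alpha>, prob_law M U)"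
    if "\<alpha> \<in> F n" "U \<in> nabla_points M n" for n \<alpha> U
    using that by (rule law_map_class)
  have contp: "continuous_map ?L ?D ?p"
    using P(1) by (rule continuous_map_eq) (auto simp: topL P(2) p)
  obtain g where g: "continuous_map ?D ?L g"
    "\<And>n \<alpha> x. \<alpha> \<in> F n \<Longrightarrow> x \<in> standard_simplex n \<Longrightarrow> g (?qD (n, \<alpha>, x)) = ?qL (n, \<alpha>, law_section n x)"
  proof (rule realization_lift[where Y = ?L and F = F and act = act and T = Delta
        and G = Delta_map and h = "\<lambda>(n, \<alpha>, x). ?qL (n, \<alpha>, law_section n x)"])
    fix n \<alpha> assume "\<alpha> \<in> F n"
    from continuous_map_compose[OF continuous_map_law_section
        continuous_map_realization_class[of \<alpha> F n "Nabla M" act "Nabla_map M", OF this]]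
    show "continuous_map (Delta n) ?L (\<lambda>x. case (n, \<alpha>, x) of (n, \<alpha>, x) \<Rightarrow> ?qL (n, \<alpha>, law_section n x))"
      by (simp add: o_def random_realization_def)
  next
    fix n m \<sigma> \<alpha> x assume "\<sigma> \<in> mor n m" "\<alpha> \<in> F m" "x \<in> topspace (Delta n)"
    then show "(case (n, act n m \<sigma> \<alpha>, x) of (n, \<alpha>, x) \<Rightarrow> ?qL (n, \<alpha>, law_section n x)) =
        (case (m, \<alpha>, Delta_map n m \<sigma> x) of (n, \<alpha>, x) \<Rightarrow> ?qL (n, \<alpha>, law_section n x))"
      by (simp add: topspace_Delta glueL law_section_in law_section_natural Delta_map_in_standard_simplex)
  qed (auto simp: geometric_realization_def topspace_Delta)
  let ?I = "top_of_set {0..1::real}"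
  obtain H where H: "continuous_map (prod_topology ?I ?L) ?L H"
    "\<And>t n \<alpha> U. t \<in> topspace ?I \<Longrightarrow> \<alpha> \<in> F n \<Longrightarrow> U \<in> nabla_points M n \<Longrightarrow>
       H (t, ?qL (n, \<alpha>, U)) = ?qL (n, \<alpha>, law_homotopy n t U)"
  proof (rule realization_lift_prod[where Y = ?L and F = F and act = act and T = "Nabla M" and Z = ?I
        and G = "Nabla_map M" and h = "\<lambda>t (n, \<alpha>, U). ?qL (n, \<alpha>, law_homotopy n t U)"])
    show "Hausdorff_space ?I"
      by (simp add: Hausdorff_space_subtopology)
    show "locally_compact_space ?I"
      by (intro compact_imp_locally_compact_space) (simp add: compact_space_subtopology)
    fix n \<alpha> assume "\<alpha> \<in> F n"
    from continuous_map_compose[OF continuous_map_law_homotopy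
        continuous_map_realization_class[of \<alpha> F n "Nabla M" act "Nabla_map M", OF this]]
    show "continuous_map (prod_topology ?I (Nabla M n)) ?L
        (\<lambda>(t, U). case (n, \<alpha>, U) of (n, \<alpha>, U) \<Rightarrow> ?qL (n, \<alpha>, law_homotopy n t U))"
      by (simp add: o_def random_realization_def case_prod_unfold)
  next
    fix t n m \<sigma> \<alpha> U assume "\<sigma> \<in> mor n m" "\<alpha> \<in> F m" "U \<in> topspace (Nabla M n)"
    then show "(case (n, act n m \<sigma> \<alpha>, U) of (n, \<alpha>, U) \<Rightarrow> ?qL (n, \<alpha>, law_homotopy n t U)) =
        (case (m, \<alpha>, Nabla_map M n m \<sigma> U) of (n, \<alpha>, U) \<Rightarrow> ?qL (n, \<alpha>, law_homotopy n t U))"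
      by (simp add: glueL law_homotopy_in law_homotopy_natural)
  qed (auto simp: random_realization_def)
  have "homotopic_with (\<lambda>h. True) ?L ?L (\<lambda>z. H (0, z)) (\<lambda>z. H (1, z))"
    unfolding homotopic_with_def using H(1) by (intro exI[of _ H]) auto
  then have "homotopic_with (\<lambda>h. True) ?L ?L id (g \<circ> ?p)"
    by (rule homotopic_with_eq)
      (auto simp: topL H(2) p g(2) prob_law_in_standard_simplex law_homotopy_0 law_homotopy_1)
  then have "homotopic_with (\<lambda>h. True) ?L ?L (g \<circ> ?p) id"
    by (rule homotopic_with_symD)
  moreover have "homotopic_with (\<lambda>h. True) ?D ?D (?p \<circ> g) id"
    using g(1) contp by (intro homotopic_with_equal continuous_map_compose[of _ ?L])
      (auto simp: topD g(2) p law_section_in prob_law_section)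
  ultimately show ?thesis
    unfolding homotopy_equivalence_def using contp g(1) by blast
qed

end

section \<open>The disc and the simplex\<close>

text \<open>The points of the simplex off the boundary.\<close>

definition open_simplex :: "nat \<Rightarrow> (nat \<Rightarrow> real) set" where
  "open_simplex n = {x \<in> standard_simplex n. \<forall>i\<le>n. 0 < x i}"

lemma barycenter_in_open_simplex: "(\<lambda>i. if i \<le> n then 1 / (real n + 1) else 0) \<in> open_simplex n"
  by (auto simp: open_simplex_def standard_simplex_def field_simps)

text \<open>The gauge of the simplex with respect to its barycenter: it vanishes at the barycenter, is
  linear on the rays from there, and has the value \<open>1\<close> exactly on the boundary.\<close>

definition simplex_gauge :: "nat \<Rightarrow> (nat \<Rightarrow> real) \<Rightarrow> real" where
  "simplex_gauge n x = Max ((\<lambda>i. 1 - (real n + 1) * x i) ` {..n})"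

text \<open>The Euclidean norm of the first \<open>n\<close> coordinates.\<close>

definition radius :: "nat \<Rightarrow> (nat \<Rightarrow> real) \<Rightarrow> real" where
  "radius n z = sqrt (\<Sum>i<n. (z i)\<^sup>2)"

text \<open>The radial map to the disc, in the coordinates \<open>x\<^sub>i - 1 / (real n + 1)\<close> for \<open>i < n\<close>.
  At the barycenter the quotient is \<open>0 / 0 = 0\<close>.\<close>

definition simplex_to_disc :: "nat \<Rightarrow> (nat \<Rightarrow> real) \<Rightarrow> nat \<Rightarrow> real" where
  "simplex_to_disc n x = (\<lambda>i. if i < n
     then simplex_gauge n x * ((x i - 1 / (real n + 1)) / radius n (\<lambda>i. x i - 1 / (real n + 1))) else 0)"

lemma continuous_on_Max_image:
  fixes f :: "'i \<Rightarrow> 'b::topological_space \<Rightarrow> real"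
  assumes "finite I" "I \<noteq> {}" "\<And>i. i \<in> I \<Longrightarrow> continuous_on S (f i)"
  shows "continuous_on S (\<lambda>x. Max ((\<lambda>i. f i x) ` I))"
  using assms
proof (induction rule: finite_ne_induct)
  case (insert i I)
  then have "continuous_on S (\<lambda>x. max (f i x) (Max ((\<lambda>i. f i x) ` I)))"
    by (intro continuous_on_max) auto
  with insert show ?case
    by simp
qed simp

lemma simplex_gauge_ge: "i \<le> n \<Longrightarrow> 1 - (real n + 1) * x i \<le> simplex_gauge n x"
  unfolding simplex_gauge_def by (intro Max_ge) auto

lemma simplex_gauge_attained:
  obtains i where "i \<le> n" "simplex_gauge n x = 1 - (real n + 1) * x i"
proof -
  have "simplex_gauge n x \<in> (\<lambda>i. 1 - (real n + 1) * x i) ` {..n}"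
    unfolding simplex_gauge_def by (intro Max_in) auto
  then show ?thesis
    using that by (elim imageE) simp
qed

lemma radius_nonneg [simp]: "0 \<le> radius n z"
  by (simp add: radius_def sum_nonneg)

lemma radius_eq_0_iff: "radius n z = 0 \<longleftrightarrow> (\<forall>i<n. z i = 0)"
  by (auto simp: radius_def sum_nonneg_eq_0_iff)

lemma radius_scale: "radius n (\<lambda>i. c * z i) = \<bar>c\<bar> * radius n z"
  by (simp add: radius_def power_mult_distrib real_sqrt_mult sum_distrib_left[symmetric])

lemma abs_le_radius: "i < n \<Longrightarrow> \<bar>z i\<bar> \<le> radius n z"
  unfolding radius_def by (intro real_le_rsqrt) (use member_le_sum[of i "{..<n}" "\<lambda>i. (z i)\<^sup>2"] in simp)

lemma simplex_last_coordinate: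
  assumes "x \<in> standard_simplex n"
  shows "x n - 1 / (real n + 1) = - (\<Sum>i<n. x i - 1 / (real n + 1))"
proof -
  have "(\<Sum>i<n. x i) + x n = 1"
    using standard_simplexD(4)[OF assms] by (simp flip: lessThan_Suc_atMost)
  moreover have "(\<Sum>i<n. x i - 1 / (real n + 1)) = (\<Sum>i<n. x i) - n / (real n + 1)"
    by (simp add: sum_subtractf)
  moreover have "n / (real n + 1) = 1 - 1 / (real n + 1)"
    by (simp add: field_simps)
  ultimately show ?thesis
    by linarith
qed

lemma simplex_gauge_bounds:
  assumes x: "x \<in> standard_simplex n"
  shows "0 \<le> simplex_gauge n x" "simplex_gauge n x \<le> 1"
    "simplex_gauge n x < 1 \<longleftrightarrow> x \<in> open_simplex n"
    "simplex_gauge n x = 0 \<longleftrightarrow> (\<forall>i\<le>n. x i = 1 / (real n + 1))"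
proof -
  have sum: "(\<Sum>i\<le>n. 1 - (real n + 1) * x i) = 0"
  proof -
    have "(\<Sum>i\<le>n. 1 - (real n + 1) * x i) = (real n + 1) - (real n + 1) * (\<Sum>i\<le>n. x i)"
      by (simp add: sum_subtractf sum_distrib_left)
    then show ?thesis
      using standard_simplexD(4)[OF x] by simp
  qed
  obtain k where k: "k \<le> n" "simplex_gauge n x = 1 - (real n + 1) * x k"
    by (rule simplex_gauge_attained)
  show "0 \<le> simplex_gauge n x"
  proof (rule ccontr)
    assume "\<not> 0 \<le> simplex_gauge n x"
    then have "1 - (real n + 1) * x i < 0" if "i \<le> n" for i
      using simplex_gauge_ge[OF that, of x] by linarith
    then have "(\<Sum>i\<le>n. 1 - (real n + 1) * x i) < (\<Sum>i\<le>n. 0)"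
      by (intro sum_strict_mono) auto
    with sum show False by simp
  qed
  show "simplex_gauge n x \<le> 1"
    using k standard_simplexD(1)[OF x] by simp
  show "simplex_gauge n x < 1 \<longleftrightarrow> x \<in> open_simplex n"
  proof
    assume less: "simplex_gauge n x < 1"
    have "0 < x i" if "i \<le> n" for i
    proof -
      have "0 < (real n + 1) * x i"
        using simplex_gauge_ge[OF that, of x] less by linarith
      then show ?thesis
        by (simp add: zero_less_mult_iff)
    qed
    then show "x \<in> open_simplex n"
      using x by (simp add: open_simplex_def)
  next
    assume "x \<in> open_simplex n"
    then have "0 < (real n + 1) * x k"
      using k by (simp add: open_simplex_def)
    then show "simplex_gauge n x < 1"
      using k by simp
  qed
  show "simplex_gauge n x = 0 \<longleftrightarrow> (\<forall>i\<le>n. x i = 1 / (real n + 1))"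
  proof
    assume 0: "simplex_gauge n x = 0"
    then have "(\<Sum>i\<le>n. (real n + 1) * x i - 1) = 0 \<longleftrightarrow> (\<forall>i\<in>{..n}. (real n + 1) * x i - 1 = 0)"
      using simplex_gauge_ge[of _ n x] by (intro sum_nonneg_eq_0_iff) auto
    moreover have "(\<Sum>i\<le>n. (real n + 1) * x i - 1) = 0"
      using sum by (simp add: sum_subtractf)
    ultimately show "\<forall>i\<le>n. x i = 1 / (real n + 1)"
      by (auto simp: field_simps)
  qed (use k in auto)
qed

lemma simplex_gauge_eq_0_iff_radius:
  assumes x: "x \<in> standard_simplex n"
  shows "radius n (\<lambda>i. x i - 1 / (real n + 1)) = 0 \<longleftrightarrow> simplex_gauge n x = 0"
proof -
  have "x n = 1 / (real n + 1)" if "\<forall>i<n. x i = 1 / (real n + 1)"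
    using simplex_last_coordinate[OF x] that by simp
  then show ?thesis
    unfolding simplex_gauge_bounds(4)[OF x] radius_eq_0_iff by (auto simp: le_less)
qed

lemma radius_simplex_to_disc:
  assumes x: "x \<in> standard_simplex n"
  shows "radius n (simplex_to_disc n x) = simplex_gauge n x"
proof -
  let ?r = "radius n (\<lambda>i. x i - 1 / (real n + 1))"
  have "radius n (simplex_to_disc n x) = radius n (\<lambda>i. (simplex_gauge n x / ?r) * (x i - 1 / (real n + 1)))"
    unfolding radius_def[of n "simplex_to_disc n x"]
      radius_def[of n "\<lambda>i. (simplex_gauge n x / ?r) * (x i - 1 / (real n + 1))"]
    by (intro arg_cong[of _ _ sqrt] sum.cong) (simp_all add: simplex_to_disc_def)
  also have "\<dots> = simplex_gauge n x / ?r * ?r"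
    using simplex_gauge_bounds(1)[OF x] by (simp only: radius_scale) simp
  also have "\<dots> = simplex_gauge n x"
    using simplex_gauge_eq_0_iff_radius[OF x] by (cases "?r = 0") simp_all
  finally show ?thesis .
qed

lemma continuous_on_simplex_to_disc:
  "continuous_on (standard_simplex n) (\<lambda>x. simplex_to_disc n x i)"
proof (cases "i < n")
  case True
  let ?S = "standard_simplex n"
  let ?r = "\<lambda>x. radius n (\<lambda>i. x i - 1 / (real n + 1))"
  have coord: "continuous_on ?S (\<lambda>x. x j)" for j
    by (rule continuous_on_subset[OF continuous_on_product_coordinates]) simp
  have r: "continuous_on ?S ?r"
    unfolding radius_def by (intro continuous_intros coord)
  have \<gamma>: "continuous_on ?S (simplex_gauge n)"
    unfolding simplex_gauge_def by (intro continuous_on_Max_image continuous_intros coord) auto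
  let ?f = "\<lambda>x. simplex_gauge n x * ((x i - 1 / (real n + 1)) / ?r x)"
  have "(?f \<longlongrightarrow> ?f x) (at x within ?S)" if x: "x \<in> ?S" for x
  proof (cases "?r x = 0")
    case False
    then show ?thesis
      using x coord r \<gamma> unfolding continuous_on_def by (intro tendsto_intros) auto
  next
    case True
    \<comment> \<open>At the barycenter the gauge tends to zero and the direction remains bounded.\<close>
    have "\<bar>?f y\<bar> \<le> simplex_gauge n y" if "y \<in> ?S" for y
    proof -
      have "\<bar>(y i - 1 / (real n + 1)) / ?r y\<bar> \<le> 1"
        using abs_le_radius[OF \<open>i < n\<close>, of "\<lambda>i. y i - 1 / (real n + 1)"]
        by (cases "?r y = 0") (simp_all add: abs_divide divide_le_eq less_le)
      from mult_left_mono[OF this simplex_gauge_bounds(1)[OF that]] show ?thesis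
        using simplex_gauge_bounds(1)[OF that] unfolding abs_mult by simp
    qed
    then have "eventually (\<lambda>y. norm (?f y) \<le> simplex_gauge n y) (at x within ?S)"
      by (auto simp: eventually_at_filter)
    moreover have "(simplex_gauge n \<longlongrightarrow> 0) (at x within ?S)"
      using \<gamma> x True simplex_gauge_eq_0_iff_radius[OF x] unfolding continuous_on_def by metis
    ultimately have "(?f \<longlongrightarrow> 0) (at x within ?S)"
      by (rule Lim_null_comparison)
    then show ?thesis
      using True by simp
  qed
  then show ?thesis
    using True by (simp add: simplex_to_disc_def continuous_on_def)
qed (simp add: simplex_to_disc_def)

text \<open>Two points with the same image lie on the same ray from the barycenter and have the same gauge.\<close>

lemma inj_on_simplex_to_disc: "inj_on (simplex_to_disc n) (standard_simplex n)"
proof (rule inj_onI)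
  fix x x' assume x: "x \<in> standard_simplex n" and x': "x' \<in> standard_simplex n"
    and eq: "simplex_to_disc n x = simplex_to_disc n x'"
  let ?v = "\<lambda>x i. x i - 1 / (real n + 1) :: real"
  have \<gamma>: "simplex_gauge n x = simplex_gauge n x'"
    using eq radius_simplex_to_disc x x' by metis
  have "x i = x' i" if i: "i \<le> n" for i
  proof (cases "simplex_gauge n x = 0")
    case True
    then show ?thesis
      using simplex_gauge_bounds(4)[OF x] simplex_gauge_bounds(4)[OF x'] \<gamma> i by simp
  next
    case False
    then have pos: "simplex_gauge n x > 0" "radius n (?v x) > 0" "radius n (?v x') > 0"
      using simplex_gauge_bounds(1)[OF x] simplex_gauge_eq_0_iff_radius[OF x]
        simplex_gauge_eq_0_iff_radius[OF x'] \<gamma> radius_nonneg by (auto simp: less_le)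
    define c where "c = radius n (?v x') / radius n (?v x)"
    have "c > 0"
      using pos by (simp add: c_def)
    have less: "?v x' j = c * ?v x j" if "j < n" for j
    proof -
      have "simplex_to_disc n x j = simplex_to_disc n x' j"
        using eq by simp
      then have "?v x j / radius n (?v x) = ?v x' j / radius n (?v x')"
        using that \<gamma> pos(1) by (simp add: simplex_to_disc_def del: times_divide_eq_right)
      then have "?v x' j = ?v x j / radius n (?v x) * radius n (?v x')"
        using pos(3) by (simp only: nonzero_divide_eq_eq) simp
      then show ?thesis
        by (simp add: c_def)
    qed
    have "?v x' n = c * ?v x n"
      using less unfolding simplex_last_coordinate[OF x] simplex_last_coordinate[OF x']
      by (simp add: sum_distrib_left)
    with less have scal: "?v x' j = c * ?v x j" if "j \<le> n" for j
      using that by (cases "j = n") auto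
    have lin: "1 - (real n + 1) * x' j = c * (1 - (real n + 1) * x j)" if "j \<le> n" for j
    proof -
      have "1 - (real n + 1) * x' j = - (real n + 1) * ?v x' j"
        by (simp add: field_simps)
      also have "\<dots> = c * (- (real n + 1) * ?v x j)"
        unfolding scal[OF that] by simp
      also have "- (real n + 1) * ?v x j = 1 - (real n + 1) * x j"
        by (simp add: field_simps)
      finally show ?thesis .
    qed
    obtain k where k: "k \<le> n" "simplex_gauge n x = 1 - (real n + 1) * x k"
      by (rule simplex_gauge_attained)
    obtain k' where k': "k' \<le> n" "simplex_gauge n x' = 1 - (real n + 1) * x' k'"
      by (rule simplex_gauge_attained)
    have "c * simplex_gauge n x \<le> simplex_gauge n x"
      using simplex_gauge_ge[OF k(1), of x'] lin[OF k(1)] k \<gamma> by simp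
    moreover have "simplex_gauge n x \<le> c * simplex_gauge n x"
      using mult_left_mono[OF simplex_gauge_ge[OF k'(1), of x], of c] lin[OF k'(1)] k' \<gamma> \<open>c > 0\<close>
      by simp
    ultimately have "c = 1"
      using pos(1) by simp
    then show ?thesis
      using scal[OF i] by simp
  qed
  moreover have "x i = x' i" if "i > n" for i
    using standard_simplexD(3)[OF x that] standard_simplexD(3)[OF x' that] by simp
  ultimately show "x = x'"
    by (metis ext not_le)
qed

lemma topspace_closed_disc:
  "topspace (closed_disc n) = {z. (\<forall>i\<ge>n. z i = 0) \<and> radius n z \<le> 1}"
  by (auto simp: closed_disc_def topspace_Euclidean_space radius_def)

lemma simplex_to_disc_surj:
  assumes z: "z \<in> topspace (closed_disc n)"
  shows "\<exists>x\<in>standard_simplex n. simplex_to_disc n x = z"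
proof (cases "radius n z = 0")
  case True
  let ?b = "\<lambda>i. if i \<le> n then 1 / (real n + 1) else 0 :: real"
  have "z = (\<lambda>i. 0)"
    using z True by (auto simp: topspace_closed_disc radius_eq_0_iff) (metis not_le)
  moreover have "simplex_to_disc n ?b = (\<lambda>i. 0)"
    by (auto simp: simplex_to_disc_def)
  ultimately show ?thesis
    using barycenter_in_open_simplex by (auto simp: open_simplex_def)
next
  case False
  define \<rho> where "\<rho> = radius n z"
  have \<rho>: "0 < \<rho>" "\<rho> \<le> 1"
    using False z by (auto simp: \<rho>_def topspace_closed_disc less_le)
  define w where "w i = (if i = n then - (\<Sum>j<n. z j) else z i)" for i
  have sumw: "(\<Sum>i\<le>n. w i) = 0"
    by (simp add: w_def flip: lessThan_Suc_atMost)
  \<comment> \<open>The ray from the barycenter in the direction \<open>w\<close> leaves the simplex at the parameter \<open>1 / m\<close>.\<close>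
  define m where "m = Max ((\<lambda>i. - (real n + 1) * w i) ` {..n})"
  have m_ge: "- (real n + 1) * w i \<le> m" if "i \<le> n" for i
    unfolding m_def using that by (intro Max_ge) auto
  have "m \<in> (\<lambda>i. - (real n + 1) * w i) ` {..n}"
    unfolding m_def by (intro Max_in) auto
  then obtain k where k: "k \<le> n" "m = - (real n + 1) * w k"
    by auto
  have "m > 0"
  proof (rule ccontr)
    assume "\<not> m > 0"
    then have "0 \<le> w i" if "i \<le> n" for i
    proof -
      have "0 \<le> (real n + 1) * w i"
        using m_ge[OF that] \<open>\<not> m > 0\<close> by (simp add: algebra_simps)
      then show ?thesis
        by (simp add: zero_le_mult_iff)
    qed
    then have "\<forall>i\<in>{..n}. w i = 0"
      using sumw by (subst (asm) sum_nonneg_eq_0_iff) auto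
    then have "radius n z = 0"
      by (auto simp: radius_eq_0_iff w_def split: if_splits)
    with False show False by simp
  qed
  define x where "x i = (if i \<le> n then 1 / (real n + 1) + \<rho> / m * w i else 0)" for i
  have lin: "1 - (real n + 1) * x i = \<rho> / m * (- (real n + 1) * w i)" if "i \<le> n" for i
  proof -
    have "(real n + 1) * (1 / (real n + 1) + c) = 1 + (real n + 1) * c" for c :: real
      by (subst distrib_left) simp
    then show ?thesis
      using that by (simp add: x_def algebra_simps add_divide_distrib)
  qed
  have le: "1 - (real n + 1) * x i \<le> \<rho>" if "i \<le> n" for i
    using mult_left_mono[OF m_ge[OF that], of "\<rho> / m"] \<open>m > 0\<close> \<rho> unfolding lin[OF that] by simp
  have nonneg: "0 \<le> x i" for i
  proof (cases "i \<le> n")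
    case True
    have "0 \<le> (real n + 1) * x i"
      using le[OF True] \<rho> by linarith
    then show ?thesis
      by (simp add: zero_le_mult_iff)
  qed (simp add: x_def)
  have sum: "(\<Sum>i\<le>n. x i) = 1"
  proof -
    have "(\<Sum>i\<le>n. x i) = (\<Sum>i\<le>n. 1 / (real n + 1)) + \<rho> / m * (\<Sum>i\<le>n. w i)"
      by (simp add: x_def sum.distrib sum_distrib_left)
    then show ?thesis
      using sumw by simp
  qed
  have x: "x \<in> standard_simplex n"
  proof -
    have "x i \<le> 1" for i
    proof (cases "i \<le> n")
      case True
      then have "x i \<le> (\<Sum>i\<le>n. x i)"
        using nonneg by (intro member_le_sum) auto
      then show ?thesis
        by (simp only: sum)
    qed (simp add: x_def)
    then show ?thesis
      using nonneg sum by (auto simp: standard_simplex_def x_def)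
  qed
  have \<gamma>: "simplex_gauge n x = \<rho>"
    unfolding simplex_gauge_def
  proof (rule Max_eqI)
    show "\<rho> \<in> (\<lambda>i. 1 - (real n + 1) * x i) ` {..n}"
      using k \<open>m > 0\<close> lin[OF k(1)] by (intro image_eqI[of _ _ k]) auto
  qed (use le in auto)
  have v: "x i - 1 / (real n + 1) = \<rho> / m * z i" if "i < n" for i
    using that by (simp add: x_def w_def)
  have "radius n (\<lambda>i. x i - 1 / (real n + 1)) = radius n (\<lambda>i. \<rho> / m * z i)"
    unfolding radius_def using v by simp
  also have "\<dots> = \<rho> / m * \<rho>"
    using \<rho> \<open>m > 0\<close> by (simp only: radius_scale \<rho>_def[symmetric]) simp
  finally have r: "radius n (\<lambda>i. x i - 1 / (real n + 1)) = \<rho> / m * \<rho>" .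
  have "simplex_to_disc n x i = z i" for i
  proof (cases "i < n")
    case True
    then show ?thesis
      unfolding simplex_to_disc_def r \<gamma> v[OF True] using \<rho> \<open>m > 0\<close> by simp
  next
    case False
    then show ?thesis
      using z by (simp add: simplex_to_disc_def topspace_closed_disc)
  qed
  with x show ?thesis
    by blast
qed

lemma compact_space_Delta: "compact_space (Delta n)"
  unfolding Delta_def by (simp add: compact_space_subtopology compactin_standard_simplex)

proposition closed_disc_homeomorphic_simplex:
  obtains \<phi> where "homeomorphic_map (closed_disc n) (Delta n) \<phi>"
    "\<And>z. z \<in> topspace (closed_disc n) \<Longrightarrow> \<phi> z \<in> open_simplex n \<longleftrightarrow> (\<Sum>i<n. (z i)\<^sup>2) < 1"
proof -
  have in_disc: "simplex_to_disc n x \<in> topspace (closed_disc n)" if "x \<in> standard_simplex n" for x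
    using radius_simplex_to_disc[OF that] simplex_gauge_bounds(2)[OF that]
    by (auto simp: topspace_closed_disc simplex_to_disc_def)
  have "homeomorphic_map (Delta n) (closed_disc n) (simplex_to_disc n)"
  proof (rule continuous_imp_homeomorphic_map)
    have "continuous_map (Delta n) euclideanreal (\<lambda>x. simplex_to_disc n x i)" for i
      unfolding Delta_def euclidean_product_topology
      using continuous_on_simplex_to_disc by (simp only: continuous_map_iff_continuous)
    then show "continuous_map (Delta n) (closed_disc n) (simplex_to_disc n)"
      using in_disc
      unfolding closed_disc_def Euclidean_space_def subtopology_subtopology
      by (auto simp: continuous_map_in_subtopology continuous_map_componentwise_UNIV topspace_Delta)
    show "Hausdorff_space (closed_disc n)"
      unfolding closed_disc_def Euclidean_space_def
      by (intro Hausdorff_space_subtopology) (simp add: Hausdorff_space_product_topology)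
    show "simplex_to_disc n ` topspace (Delta n) = topspace (closed_disc n)"
      using in_disc simplex_to_disc_surj by (force simp: topspace_Delta)
  qed (auto simp: compact_space_Delta topspace_Delta inj_on_simplex_to_disc)
  then obtain \<phi> where \<phi>: "homeomorphic_maps (Delta n) (closed_disc n) (simplex_to_disc n) \<phi>"
    using homeomorphic_map_maps by blast
  show ?thesis
  proof (rule that)
    show "homeomorphic_map (closed_disc n) (Delta n) \<phi>"
      using \<phi> homeomorphic_maps_sym homeomorphic_map_maps by blast
    fix z assume "z \<in> topspace (closed_disc n)"
    then have "\<phi> z \<in> standard_simplex n" "simplex_to_disc n (\<phi> z) = z"
      using \<phi> continuous_map_image_subset_topspace[of "closed_disc n" "Delta n" \<phi>]
      by (auto simp: homeomorphic_maps_def topspace_Delta)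
    then show "\<phi> z \<in> open_simplex n \<longleftrightarrow> (\<Sum>i<n. (z i)\<^sup>2) < 1"
      using simplex_gauge_bounds(3) radius_simplex_to_disc by (metis radius_def real_sqrt_lt_1_iff)
  qed
qed

section \<open>Morphisms and faces\<close>

lemma mor_strict_mono: "\<sigma> \<in> mor n m \<Longrightarrow> i < j \<Longrightarrow> j \<le> n \<Longrightarrow> \<sigma> i < \<sigma> j"
  by (auto simp: mor_def dest: strict_mono_onD[of _ _ i j])

lemma mor_inj: "\<sigma> \<in> mor n m \<Longrightarrow> inj_on \<sigma> {..n}"
  by (auto simp: mor_def intro: strict_mono_on_imp_inj_on)

lemma finite_mor [simp]: "finite (mor n m)"
  by (rule finite_subset[of _ "{..n} \<rightarrow>\<^sub>E {..m}"]) (auto simp: mor_def intro: finite_PiE)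

lemma id_in_mor: "restrict id {..n} \<in> mor n n"
  by (auto simp: mor_def strict_mono_on_def)

lemma compose_in_mor:
  assumes "\<rho> \<in> mor n k" "\<tau> \<in> mor k m"
  shows "compose {..n} \<tau> \<rho> \<in> mor n m"
proof -
  have "strict_mono_on {..n} (compose {..n} \<tau> \<rho>)"
    using assms by (intro strict_mono_onI) (simp add: compose_eq mor_strict_mono mor_imp_le)
  moreover have "compose {..n} \<tau> \<rho> \<in> {..n} \<rightarrow>\<^sub>E {..m}"
  proof (rule PiE_I)
    show "compose {..n} \<tau> \<rho> i \<in> {..m}" if "i \<in> {..n}" for i
      using that mor_imp_le[OF assms(2) mor_imp_le[OF assms(1), of i]] by (simp add: compose_eq)
  qed (simp add: compose_def)
  ultimately show ?thesis
    by (simp add: mor_def)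
qed

lemma mor_lower: "\<sigma> \<in> mor n m \<Longrightarrow> i \<le> n \<Longrightarrow> i \<le> \<sigma> i"
proof (induction i)
  case (Suc i)
  then show ?case
    using mor_strict_mono[of \<sigma> n m i "Suc i"] by simp
qed simp

lemma mor_upper: "\<sigma> \<in> mor n m \<Longrightarrow> j \<le> n \<Longrightarrow> \<sigma> (n - j) + j \<le> m"
proof (induction j)
  case 0
  then show ?case
    by (simp add: mor_imp_le)
next
  case (Suc j)
  then have "n - Suc j < n - j"
    by arith
  then show ?case
    using Suc mor_strict_mono[of \<sigma> n m "n - Suc j" "n - j"] by simp
qed

lemma mor_dim_le: "\<sigma> \<in> mor n m \<Longrightarrow> n \<le> m"
  using mor_lower[of \<sigma> n m n] mor_imp_le[of \<sigma> n m n] by simp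

lemma mor_self: "mor n n = {restrict id {..n}}"
proof -
  have "\<sigma> = restrict id {..n}" if \<sigma>: "\<sigma> \<in> mor n n" for \<sigma>
  proof
    fix i
    show "\<sigma> i = restrict id {..n} i"
    proof (cases "i \<le> n")
      case True
      then show ?thesis
        using mor_lower[OF \<sigma> True] mor_upper[OF \<sigma>, of "n - i"] by simp
    next
      case False
      then show ?thesis
        using \<sigma> by (auto simp: mor_def PiE_iff extensional_def)
    qed
  qed
  then show ?thesis
    using id_in_mor by blast
qed

lemma Delta_map_at:
  assumes "\<sigma> \<in> mor n m" "i \<le> n"
  shows "Delta_map n m \<sigma> x (\<sigma> i) = x i"
proof -
  have "{j. j \<le> n \<and> \<sigma> j = \<sigma> i} = {i}"
    using assms mor_inj[OF assms(1)] by (auto dest: inj_onD)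
  then show ?thesis
    by (simp add: Delta_map_def)
qed

lemma Delta_map_outside: "k \<notin> \<sigma> ` {..n} \<Longrightarrow> Delta_map n m \<sigma> x k = 0"
  unfolding Delta_map_def by (intro sum.neutral) auto

text \<open>Every point of a simplex lies in the interior of a face, the one spanned by the vertices with
  nonzero coordinate.\<close>

lemma standard_simplex_normal_form:
  assumes x: "x \<in> standard_simplex n"
  obtains k \<sigma> y where "k \<le> n" "\<sigma> \<in> mor k n" "y \<in> open_simplex k" "x = Delta_map k n \<sigma> y"
    "x \<notin> open_simplex n \<Longrightarrow> k < n"
proof -
  define S where "S = {i. i \<le> n \<and> 0 < x i}"
  have S: "finite S" "S \<subseteq> {..n}"
    by (auto simp: S_def)
  have out: "x i = 0" if "i \<notin> S" for i
    using standard_simplexD(1,3)[OF x, of i] that by (auto simp: S_def not_le less_le)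
  have sumS: "(\<Sum>i\<in>S. x i) = 1"
    using sum.mono_neutral_left[of "{..n}" S x] S out standard_simplexD(4)[OF x] by auto
  then have "card S \<noteq> 0"
    using S by auto
  then obtain k where k: "card S = Suc k"
    using not0_implies_Suc by blast
  obtain h where h: "bij_betw h {..k} S" "strict_mono_on {..k} h"
    using ex_bij_betw_strict_mono_card[OF S(1)] k by (auto simp: lessThan_Suc_atMost)
  define \<sigma> where "\<sigma> = restrict h {..k}"
  have \<sigma>: "\<sigma> \<in> mor k n"
    using h S(2) by (auto simp: mor_def \<sigma>_def strict_mono_on_def bij_betw_def)
  have im: "\<sigma> ` {..k} = S" and inj: "inj_on \<sigma> {..k}"
    using h(1) mor_inj[OF \<sigma>] by (auto simp: \<sigma>_def bij_betw_def)
  define y where "y i = (if i \<le> k then x (\<sigma> i) else 0)" for i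
  have "y \<in> open_simplex k"
  proof -
    have "(\<Sum>i\<le>k. y i) = (\<Sum>i\<in>\<sigma> ` {..k}. x i)"
      using inj by (simp add: y_def sum.reindex)
    then have "(\<Sum>i\<le>k. y i) = 1"
      using im sumS by simp
    moreover have "0 < y i" if "i \<le> k" for i
      using that im by (auto simp: y_def S_def)
    ultimately show ?thesis
      using standard_simplexD(1,2)[OF x] by (auto simp: open_simplex_def standard_simplex_def y_def)
  qed
  moreover have "x = Delta_map k n \<sigma> y"
  proof
    fix j
    show "x j = Delta_map k n \<sigma> y j"
    proof (cases "j \<in> \<sigma> ` {..k}")
      case True
      then show ?thesis
        using Delta_map_at[OF \<sigma>] by (auto simp: y_def)
    next
      case False
      then show ?thesis
        using out im by (simp add: Delta_map_outside)
    qed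
  qed
  moreover have "k < n" if "x \<notin> open_simplex n"
  proof -
    have "S \<noteq> {..n}"
      using that x by (auto simp: open_simplex_def S_def)
    then have "card S < card {..n}"
      using S(2) by (intro psubset_card_mono) auto
    then show ?thesis
      using k by simp
  qed
  ultimately show ?thesis
    using that[of k \<sigma> y] \<sigma> mor_dim_le[OF \<sigma>] by blast
qed

section \<open>The geometric realization as a CW complex\<close>

lemma Hausdorff_space_if_separated:
  assumes "\<And>x y. \<lbrakk>x \<in> topspace X; y \<in> topspace X; x \<noteq> y\<rbrakk> \<Longrightarrow>
    \<exists>f. continuous_map X euclideanreal f \<and> f x \<noteq> f y"
  shows "Hausdorff_space X"
  unfolding Hausdorff_space_def
proof (intro allI impI, elim conjE)
  fix x y assume xy: "x \<in> topspace X" "y \<in> topspace X" "x \<noteq> y"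
  then obtain f where f: "continuous_map X euclideanreal f" "f x \<noteq> f y"
    using assms by blast
  obtain U V where UV: "open U" "open V" "f x \<in> U" "f y \<in> V" "U \<inter> V = {}"
    using hausdorff[OF f(2)] by blast
  show "\<exists>U V. openin X U \<and> openin X V \<and> x \<in> U \<and> y \<in> V \<and> disjnt U V"
  proof (intro exI conjI)
    show "openin X {z \<in> topspace X. f z \<in> U}" "openin X {z \<in> topspace X. f z \<in> V}"
      using f(1) UV by (auto intro: openin_continuous_map_preimage)
  qed (use UV xy in \<open>auto simp: disjnt_iff\<close>)
qed

text \<open>Vanishing is required at all points with a zero coordinate, in the simplex or not.\<close>

definition vanishes_on_boundary :: "nat \<Rightarrow> ((nat \<Rightarrow> real) \<Rightarrow> real) \<Rightarrow> bool" where
  "vanishes_on_boundary n h \<longleftrightarrow> (\<forall>x. (\<exists>i\<le>n. x i = 0) \<longrightarrow> h x = 0)"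

context pre_simplicial_set
begin

text \<open>The point of the geometric realization with barycentric coordinates \<open>x\<close> in the simplex \<open>\<alpha>\<close>.\<close>

abbreviation point :: "nat \<Rightarrow> 'a \<Rightarrow> (nat \<Rightarrow> real) \<Rightarrow> (nat \<times> 'a \<times> (nat \<Rightarrow> real)) set" where
  "point n \<alpha> x \<equiv> realization_class F act Delta Delta_map (n, \<alpha>, x)"

text \<open>A function \<open>h\<close> on the simplex of \<open>\<alpha>\<close> that vanishes on the boundary extends to the whole
  realization, by zero on the simplices that do not have \<open>\<alpha>\<close> as a face. On the simplex of
  \<open>\<beta>\<close>, the values of \<open>h\<close> are summed over all faces \<open>\<sigma>\<close> of \<open>\<beta>\<close> that
  are equal to \<open>\<alpha>\<close>. The coordinates beyond \<open>n\<close> are set to zero because \<open>\<sigma>\<close> has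
  no meaning there.\<close>

definition extension_by_zero ::
  "nat \<Rightarrow> 'a \<Rightarrow> ((nat \<Rightarrow> real) \<Rightarrow> real) \<Rightarrow> nat \<times> 'a \<times> (nat \<Rightarrow> real) \<Rightarrow> real" where
  "extension_by_zero n \<alpha> h = (\<lambda>(m, \<beta>, x).
     \<Sum>\<sigma> | \<sigma> \<in> mor n m \<and> act n m \<sigma> \<beta> = \<alpha>. h (\<lambda>i. if i \<le> n then x (\<sigma> i) else 0))"

lemma extension_by_zero_natural:
  assumes h: "vanishes_on_boundary n h" and \<tau>: "\<tau> \<in> mor k m" and \<beta>: "\<beta> \<in> F m"
  shows "extension_by_zero n \<alpha> h (k, act k m \<tau> \<beta>, y) =
    extension_by_zero n \<alpha> h (m, \<beta>, Delta_map k m \<tau> y)"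
proof -
  define S where "S = {\<sigma> \<in> mor n m. act n m \<sigma> \<beta> = \<alpha>}"
  define T where "T = {\<rho> \<in> mor n k. act n k \<rho> (act k m \<tau> \<beta>) = \<alpha>}"
  define g where "g \<sigma> = h (\<lambda>i. if i \<le> n then Delta_map k m \<tau> y (\<sigma> i) else 0)" for \<sigma> :: "nat \<Rightarrow> nat"
  \<comment> \<open>Only the faces contained in the face \<open>\<tau>\<close> contribute, and they are the faces of that face.\<close>
  have "(\<Sum>\<sigma>\<in>S. g \<sigma>) = (\<Sum>\<sigma>\<in>{\<sigma> \<in> S. \<sigma> ` {..n} \<subseteq> \<tau> ` {..k}}. g \<sigma>)"
  proof (rule sum.mono_neutral_right)
    show "finite S" by (simp add: S_def)
    show "\<forall>\<sigma>\<in>S - {\<sigma> \<in> S. \<sigma> ` {..n} \<subseteq> \<tau> ` {..k}}. g \<sigma> = 0"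
    proof
      fix \<sigma> assume "\<sigma> \<in> S - {\<sigma> \<in> S. \<sigma> ` {..n} \<subseteq> \<tau> ` {..k}}"
      then obtain i where i: "i \<le> n" "\<sigma> i \<notin> \<tau> ` {..k}" by auto
      then show "g \<sigma> = 0"
        unfolding g_def
        by (intro h[unfolded vanishes_on_boundary_def, rule_format] exI[of _ i])
          (simp add: Delta_map_outside)
    qed
  qed auto
  also have "\<dots> = (\<Sum>\<rho>\<in>T. h (\<lambda>i. if i \<le> n then y (\<rho> i) else 0))"
  proof (rule sum.reindex_bij_witness[where i = "\<lambda>\<rho>. compose {..n} \<tau> \<rho>" and
        j = "\<lambda>\<sigma>. \<lambda>i\<in>{..n}. inv_into {..k} \<tau> (\<sigma> i)"])
    fix \<sigma> assume "\<sigma> \<in> {\<sigma> \<in> S. \<sigma> ` {..n} \<subseteq> \<tau> ` {..k}}"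
    then have \<sigma>: "\<sigma> \<in> mor n m" "act n m \<sigma> \<beta> = \<alpha>" "\<And>i. i \<le> n \<Longrightarrow> \<sigma> i \<in> \<tau> ` {..k}"
      by (auto simp: S_def)
    define \<rho> where "\<rho> = (\<lambda>i\<in>{..n}. inv_into {..k} \<tau> (\<sigma> i))"
    have \<rho>i: "\<rho> i \<le> k" "\<tau> (\<rho> i) = \<sigma> i" if "i \<le> n" for i
      using that \<sigma>(3)[OF that] inv_into_into[of "\<sigma> i" \<tau> "{..k}"] f_inv_into_f[of "\<sigma> i" \<tau> "{..k}"]
      by (auto simp: \<rho>_def)
    have "\<rho> i < \<rho> j" if "i < j" "j \<le> n" for i j
    proof (rule ccontr)
      assume "\<not> \<rho> i < \<rho> j"
      then have "\<tau> (\<rho> j) \<le> \<tau> (\<rho> i)"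
        using mor_strict_mono[OF \<tau>, of "\<rho> j" "\<rho> i"] \<rho>i that by (cases "\<rho> i = \<rho> j") auto
      then show False
        using mor_strict_mono[OF \<sigma>(1) that] \<rho>i that by simp
    qed
    then have \<rho>: "\<rho> \<in> mor n k"
      using \<rho>i(1) by (auto simp: mor_def strict_mono_on_def \<rho>_def)
    have eq: "compose {..n} \<tau> \<rho> = \<sigma>"
    proof
      fix i
      show "compose {..n} \<tau> \<rho> i = \<sigma> i"
        using \<rho>i(2) \<sigma>(1) by (cases "i \<le> n") (auto simp: compose_def mor_def PiE_iff extensional_def)
    qed
    show "compose {..n} \<tau> (\<lambda>i\<in>{..n}. inv_into {..k} \<tau> (\<sigma> i)) = \<sigma>"
      using eq by (simp add: \<rho>_def)
    have "act n k \<rho> (act k m \<tau> \<beta>) = \<alpha>"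
      using act_compose[OF \<rho> \<tau> \<beta>] eq \<sigma>(2) by simp
    then show "(\<lambda>i\<in>{..n}. inv_into {..k} \<tau> (\<sigma> i)) \<in> T"
      using \<rho> by (simp add: T_def \<rho>_def)
    have "(if i \<le> n then y (\<rho> i) else 0) = (if i \<le> n then Delta_map k m \<tau> y (\<sigma> i) else 0)" for i
      using Delta_map_at[OF \<tau> \<rho>i(1)] \<rho>i(2) by auto
    then show "h (\<lambda>i. if i \<le> n then y ((\<lambda>i\<in>{..n}. inv_into {..k} \<tau> (\<sigma> i)) i) else 0) = g \<sigma>"
      unfolding g_def \<rho>_def[symmetric] by presburger
  next
    fix \<rho> assume "\<rho> \<in> T"
    then have \<rho>: "\<rho> \<in> mor n k" "act n k \<rho> (act k m \<tau> \<beta>) = \<alpha>"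
      by (auto simp: T_def)
    show "compose {..n} \<tau> \<rho> \<in> {\<sigma> \<in> S. \<sigma> ` {..n} \<subseteq> \<tau> ` {..k}}"
      using \<rho> compose_in_mor[OF \<rho>(1) \<tau>] act_compose[OF \<rho>(1) \<tau> \<beta>] mor_imp_le[OF \<rho>(1)]
      by (auto simp: S_def compose_eq)
    show "(\<lambda>i\<in>{..n}. inv_into {..k} \<tau> (compose {..n} \<tau> \<rho> i)) = \<rho>"
    proof
      fix i
      show "(\<lambda>i\<in>{..n}. inv_into {..k} \<tau> (compose {..n} \<tau> \<rho> i)) i = \<rho> i"
        using \<rho>(1) mor_imp_le[OF \<rho>(1), of i] inv_into_f_f[OF mor_inj[OF \<tau>], of "\<rho> i"]
        by (cases "i \<le> n") (auto simp: compose_eq mor_def PiE_iff extensional_def)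
    qed
  qed
  finally show ?thesis
    by (simp add: extension_by_zero_def S_def T_def g_def)
qed

lemma extension_by_zero_same_dim:
  assumes "x \<in> standard_simplex n" "\<beta> \<in> F n"
  shows "extension_by_zero n \<alpha> h (n, \<beta>, x) = (if \<beta> = \<alpha> then h x else 0)"
proof -
  have x: "(\<lambda>i. if i \<le> n then x (restrict id {..n} i) else 0) = x"
    using standard_simplexD(3)[OF assms(1)] by (auto simp: not_le)
  have "{\<sigma>. \<sigma> \<in> mor n n \<and> act n n \<sigma> \<beta> = \<alpha>} = (if \<beta> = \<alpha> then {restrict id {..n}} else {})"
    using act_id[OF assms(2)] by (auto simp: mor_self)
  then show ?thesis
    using x by (simp add: extension_by_zero_def)
qed

lemma extension_by_zero_low_dim:
  assumes "m < n"
  shows "extension_by_zero n \<alpha> h (m, \<beta>, x) = 0"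
proof -
  have "{\<sigma>. \<sigma> \<in> mor n m \<and> act n m \<sigma> \<beta> = \<alpha>} = {}"
    using assms mor_dim_le by fastforce
  then show ?thesis
    by (simp add: extension_by_zero_def del: Collect_empty_eq)
qed

lemma topspace_geometric_realization:
  "topspace (geometric_realization F act) =
     {point n \<alpha> x | n \<alpha> x. \<alpha> \<in> F n \<and> x \<in> standard_simplex n}"
  unfolding geometric_realization_def topspace_realization topspace_Delta ..

lemma point_in_topspace:
  "\<alpha> \<in> F n \<Longrightarrow> x \<in> standard_simplex n \<Longrightarrow> point n \<alpha> x \<in> topspace (geometric_realization F act)"
  unfolding topspace_geometric_realization
  by (rule CollectI, rule exI[of _ n], rule exI[of _ \<alpha>], rule exI[of _ x]) simp

lemma point_face:
  assumes "\<sigma> \<in> mor n m" "\<alpha> \<in> F m" "x \<in> standard_simplex n"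
  shows "point m \<alpha> (Delta_map n m \<sigma> x) = point n (act n m \<sigma> \<alpha>) x"
  using assms by (intro realization_class_eq[symmetric])
    (auto simp: act_closed topspace_Delta Delta_map_in_standard_simplex)

lemma extension_by_zero_continuous:
  assumes h: "vanishes_on_boundary n h" "continuous_map (powertop_real UNIV) euclideanreal h"
  obtains f where "continuous_map (geometric_realization F act) euclideanreal f"
    "\<And>m \<beta> x. \<beta> \<in> F m \<Longrightarrow> x \<in> standard_simplex m \<Longrightarrow> f (point m \<beta> x) = extension_by_zero n \<alpha> h (m, \<beta>, x)"
proof (rule realization_lift[where Y = euclideanreal and F = F and act = act and T = Delta
      and G = Delta_map and h = "extension_by_zero n \<alpha> h"])
  fix m \<beta> assume "\<beta> \<in> F m"
  have "continuous_map (Delta m) euclideanreal (\<lambda>x. h (\<lambda>i. if i \<le> n then x (\<sigma> i) else 0))" for \<sigma>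
  proof -
    have "continuous_map (Delta m) euclideanreal (\<lambda>x. if i \<le> n then x (\<sigma> i) else 0)" for i
      by (cases "i \<le> n") (simp_all add: continuous_map_Delta_component)
    then have "continuous_map (Delta m) (powertop_real UNIV) (\<lambda>x i. if i \<le> n then x (\<sigma> i) else 0)"
      by (simp add: continuous_map_componentwise_UNIV)
    from continuous_map_compose[OF this h(2)] show ?thesis
      by (simp add: o_def)
  qed
  then show "continuous_map (Delta m) euclideanreal (\<lambda>x. extension_by_zero n \<alpha> h (m, \<beta>, x))"
    unfolding extension_by_zero_def prod.case by (intro continuous_map_sum) auto
next
  fix k m \<sigma> \<beta> x assume "\<sigma> \<in> mor k m" "\<beta> \<in> F m"
  then show "extension_by_zero n \<alpha> h (k, act k m \<sigma> \<beta>, x) =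
      extension_by_zero n \<alpha> h (m, \<beta>, Delta_map k m \<sigma> x)"
    by (rule extension_by_zero_natural[OF h(1)])
qed (use that in \<open>auto simp: geometric_realization_def topspace_Delta\<close>)

text \<open>A point in the interior of a simplex is determined by the values of these functions for the
  product of the coordinates and the multiples of that product by one coordinate. The simplex of
  larger dimension is used: its functions vanish on all simplices of smaller dimension.\<close>

lemma interior_points_separated:
  assumes \<alpha>: "\<alpha> \<in> F n" "x \<in> open_simplex n" and \<beta>: "\<beta> \<in> F m" "y \<in> standard_simplex m" and "m \<le> n"
    and eq: "\<And>f. continuous_map (geometric_realization F act) euclideanreal f \<Longrightarrow>
      f (point n \<alpha> x) = f (point m \<beta> y)"
  shows "m = n \<and> \<beta> = \<alpha> \<and> y = x"
proof -
  have x: "x \<in> standard_simplex n" "\<And>i. i \<le> n \<Longrightarrow> 0 < x i"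
    using \<alpha> by (auto simp: open_simplex_def)
  have ext: "extension_by_zero n \<alpha> h (m, \<beta>, y) = h x"
    if h: "vanishes_on_boundary n h" "continuous_map (powertop_real UNIV) euclideanreal h" for h
  proof -
    obtain f where "continuous_map (geometric_realization F act) euclideanreal f"
      "\<And>m \<beta> x. \<beta> \<in> F m \<Longrightarrow> x \<in> standard_simplex m \<Longrightarrow> f (point m \<beta> x) = extension_by_zero n \<alpha> h (m, \<beta>, x)"
      using extension_by_zero_continuous[OF h] by metis
    then show ?thesis
      using eq[of f] \<alpha> \<beta> x by (simp add: extension_by_zero_same_dim)
  qed
  define \<pi> where "\<pi> z = (\<Prod>i\<le>n. z i)" for z :: "nat \<Rightarrow> real"
  have \<pi>: "vanishes_on_boundary n \<pi>" "continuous_map (powertop_real UNIV) euclideanreal \<pi>"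
    unfolding \<pi>_def vanishes_on_boundary_def
    by (auto intro!: continuous_map_prod continuous_map_product_projection)
  have "\<pi> x > 0"
    using x(2) by (auto simp: \<pi>_def intro: prod_pos)
  have "m = n"
    using ext[OF \<pi>] \<open>\<pi> x > 0\<close> \<open>m \<le> n\<close> extension_by_zero_low_dim[of m n \<alpha> \<pi> \<beta> y]
    by (cases "m < n") auto
  have ext': "(if \<beta> = \<alpha> then h y else 0) = h x"
    if "vanishes_on_boundary n h" "continuous_map (powertop_real UNIV) euclideanreal h" for h
    using ext[OF that] \<beta> \<open>m = n\<close> by (simp add: extension_by_zero_same_dim)
  have "\<beta> = \<alpha>" and \<pi>y: "\<pi> y = \<pi> x"
    using ext'[OF \<pi>] \<open>\<pi> x > 0\<close> by (auto split: if_splits)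
  have "y j = x j" for j
  proof (cases "j \<le> n")
    case True
    have "y j * \<pi> y = x j * \<pi> x"
    proof -
      have 1: "vanishes_on_boundary n (\<lambda>z. z j * \<pi> z)"
        using \<pi>(1) by (auto simp: vanishes_on_boundary_def)
      have 2: "continuous_map (powertop_real UNIV) euclideanreal (\<lambda>z. z j * \<pi> z)"
        using \<pi>(2) by (intro continuous_intros) auto
      show ?thesis
        using ext'[OF 1 2] \<open>\<beta> = \<alpha>\<close> by simp
    qed
    then show ?thesis
      using \<pi>y \<open>\<pi> x > 0\<close> by simp
  next
    case False
    then show ?thesis
      using standard_simplexD(3)[OF x(1), of j] standard_simplexD(3)[OF \<beta>(2), of j] \<open>m = n\<close> by simp
  qed
  then show ?thesis
    using \<open>m = n\<close> \<open>\<beta> = \<alpha>\<close> by blast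
qed

lemma interior_point_unique:
  assumes "\<alpha> \<in> F n" "x \<in> open_simplex n" "\<beta> \<in> F m" "y \<in> open_simplex m"
    and "\<And>f. continuous_map (geometric_realization F act) euclideanreal f \<Longrightarrow>
      f (point n \<alpha> x) = f (point m \<beta> y)"
  shows "m = n \<and> \<beta> = \<alpha> \<and> y = x"
proof (cases "m \<le> n")
  case True
  show ?thesis
    by (rule interior_points_separated[OF assms(1-3)])
      (use assms(4,5) True in \<open>auto simp: open_simplex_def\<close>)
next
  case False
  have "n = m \<and> \<alpha> = \<beta> \<and> x = y"
    by (rule interior_points_separated[OF assms(3,4,1)])
      (use assms(2) assms(5)[symmetric] False in \<open>auto simp: open_simplex_def\<close>)
  then show ?thesis by blast
qed

lemma point_normal_form:
  assumes "\<alpha> \<in> F n" "x \<in> standard_simplex n"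
  obtains k \<sigma> y where "k \<le> n" "\<sigma> \<in> mor k n" "y \<in> open_simplex k"
    "point n \<alpha> x = point k (act k n \<sigma> \<alpha>) y" "x \<notin> open_simplex n \<Longrightarrow> k < n"
proof -
  obtain k \<sigma> y where *: "k \<le> n" "\<sigma> \<in> mor k n" "y \<in> open_simplex k" "x = Delta_map k n \<sigma> y"
    "x \<notin> open_simplex n \<Longrightarrow> k < n"
    using standard_simplex_normal_form[OF assms(2)] by blast
  have "point n \<alpha> x = point k (act k n \<sigma> \<alpha>) y"
    unfolding *(4) using * assms(1) by (intro point_face) (auto simp: open_simplex_def)
  then show ?thesis
    by (rule that[OF *(1-3) _ *(5)])
qed

lemma topspace_normal_form:
  assumes "p \<in> topspace (geometric_realization F act)"
  obtains k \<alpha> y where "\<alpha> \<in> F k" "y \<in> open_simplex k" "p = point k \<alpha> y"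
proof -
  obtain n \<beta> x where p: "p = point n \<beta> x" "\<beta> \<in> F n" "x \<in> standard_simplex n"
    using assms by (auto simp: topspace_geometric_realization)
  then obtain k \<sigma> y where "\<sigma> \<in> mor k n" "y \<in> open_simplex k" "p = point k (act k n \<sigma> \<beta>) y"
    by (metis point_normal_form)
  then show ?thesis
    using that act_closed p(2) by blast
qed

lemma Hausdorff_space_geometric_realization: "Hausdorff_space (geometric_realization F act)"
proof (rule Hausdorff_space_if_separated, rule ccontr)
  fix p p' assume "p \<in> topspace (geometric_realization F act)"
    "p' \<in> topspace (geometric_realization F act)" "p \<noteq> p'"
    and eq: "\<not> (\<exists>f. continuous_map (geometric_realization F act) euclideanreal f \<and> f p \<noteq> f p')"
  then obtain n \<alpha> x m \<beta> y where *: "\<alpha> \<in> F n" "x \<in> open_simplex n" "p = point n \<alpha> x"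
    "\<beta> \<in> F m" "y \<in> open_simplex m" "p' = point m \<beta> y"
    by (metis topspace_normal_form)
  then have "m = n \<and> \<beta> = \<alpha> \<and> y = x"
    using eq by (intro interior_point_unique) auto
  with * \<open>p \<noteq> p'\<close> show False by simp
qed

text \<open>The open cell of a simplex. Its index \<open>(n, \<alpha>)\<close> contains the dimension because the sets
  \<open>F n\<close> need not be disjoint.\<close>

definition cell :: "nat \<times> 'a \<Rightarrow> (nat \<times> 'a \<times> (nat \<Rightarrow> real)) set set" where
  "cell = (\<lambda>(n, \<alpha>). point n \<alpha> ` open_simplex n)"

lemma point_in_cell_iff:
  assumes "\<alpha> \<in> F n" "x \<in> standard_simplex n"
  shows "point n \<alpha> x \<in> cell (n, \<alpha>) \<longleftrightarrow> x \<in> open_simplex n"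
proof
  assume "point n \<alpha> x \<in> cell (n, \<alpha>)"
  then obtain y where y: "y \<in> open_simplex n" "point n \<alpha> x = point n \<alpha> y"
    by (auto simp: cell_def)
  have "n = n \<and> \<alpha> = \<alpha> \<and> x = y"
    by (rule interior_points_separated) (use assms y in auto)
  with y show "x \<in> open_simplex n" by simp
qed (auto simp: cell_def)

lemma cell_disjoint:
  assumes "\<alpha> \<in> F n" "\<beta> \<in> F m" "p \<in> cell (n, \<alpha>)" "p \<in> cell (m, \<beta>)"
  shows "(n, \<alpha>) = (m, \<beta>)"
proof -
  obtain x y where "x \<in> open_simplex n" "p = point n \<alpha> x" "y \<in> open_simplex m" "p = point m \<beta> y"
    using assms by (auto simp: cell_def)
  then have "m = n \<and> \<beta> = \<alpha> \<and> y = x"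
    using assms by (intro interior_point_unique) auto
  then show ?thesis by simp
qed

lemma continuous_map_point:
  assumes "\<alpha> \<in> F n"
  shows "continuous_map (Delta n) (geometric_realization F act) (point n \<alpha>)"
  using continuous_map_realization_class[of \<alpha> F n Delta act Delta_map, OF assms]
  by (simp add: geometric_realization_def)

text \<open>The segment from a point of the closed simplex to the barycenter runs, except for its first
  point, in the open simplex.\<close>

lemma point_in_closure_of_cell:
  assumes \<alpha>: "\<alpha> \<in> F n" and x: "x \<in> standard_simplex n"
  shows "point n \<alpha> x \<in> geometric_realization F act closure_of cell (n, \<alpha>)"
proof -
  let ?X = "geometric_realization F act"
  let ?b = "\<lambda>i. if i \<le> n then 1 / (real n + 1) else 0 :: real"
  define c where "c t = (\<lambda>i. (1 - t) * x i + t * ?b i)" for t :: real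
  have b: "?b \<in> open_simplex n"
    by (rule barycenter_in_open_simplex)
  have c: "c t \<in> standard_simplex n" if "0 \<le> t" "t \<le> 1" for t
    unfolding c_def using x b that by (intro convex_standard_simplex) (auto simp: open_simplex_def)
  have c': "c t \<in> open_simplex n" if "0 < t" "t \<le> 1" for t
    using c[of t] that b standard_simplexD(1)[OF x]
    by (auto simp: open_simplex_def c_def intro!: add_nonneg_pos)
  have "continuous_map (top_of_set {0..1}) (Delta n) c"
    unfolding Delta_def continuous_map_in_subtopology continuous_map_componentwise_UNIV c_def
    using c by (auto simp: c_def intro!: continuous_intros)
  from continuous_map_compose[OF this continuous_map_point[OF \<alpha>]]
  have cont: "continuous_map (top_of_set {0..1}) ?X (point n \<alpha> \<circ> c)" .
  have "closedin (top_of_set {0..1}) {t \<in> topspace (top_of_set {0..1}).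
      (point n \<alpha> \<circ> c) t \<in> ?X closure_of cell (n, \<alpha>)}"
    by (rule closedin_continuous_map_preimage[OF cont]) simp
  then have "closed {t \<in> {0..1}. (point n \<alpha> \<circ> c) t \<in> ?X closure_of cell (n, \<alpha>)}"
    using closedin_closed_trans by fastforce
  moreover have "{0<..1} \<subseteq> {t \<in> {0..1}. (point n \<alpha> \<circ> c) t \<in> ?X closure_of cell (n, \<alpha>)}"
  proof clarsimp
    fix t :: real assume t: "0 < t" "t \<le> 1"
    have "point n \<alpha> (c t) \<in> topspace ?X \<inter> cell (n, \<alpha>)"
      unfolding cell_def prod.case using \<alpha> c'[OF t] c[of t] t
      by (intro IntI imageI point_in_topspace) auto
    then show "point n \<alpha> (c t) \<in> ?X closure_of cell (n, \<alpha>)"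
      by (rule subsetD[OF closure_of_subset_Int])
  qed
  ultimately have "closure {0<..1} \<subseteq> {t \<in> {0..1}. (point n \<alpha> \<circ> c) t \<in> ?X closure_of cell (n, \<alpha>)}"
    by (rule closure_minimal[rotated])
  then have "0 \<in> {t \<in> {0..1}. (point n \<alpha> \<circ> c) t \<in> ?X closure_of cell (n, \<alpha>)}"
    by (rule subsetD) simp
  then show ?thesis
    by (simp add: c_def)
qed

theorem cw_complex_geometric_realization: "cw_complex (geometric_realization F act)"
proof -
  let ?X = "geometric_realization F act"
  define I where "I = (SIGMA n:UNIV. F n)"
  define C where "C = cell ` I"
  have "\<forall>n. \<exists>\<phi>. homeomorphic_map (closed_disc n) (Delta n) \<phi> \<and>
      (\<forall>z\<in>topspace (closed_disc n). \<phi> z \<in> open_simplex n \<longleftrightarrow> (\<Sum>i<n. (z i)\<^sup>2) < 1)"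
    using closed_disc_homeomorphic_simplex by metis
  then obtain \<phi> where \<phi>: "\<And>n. homeomorphic_map (closed_disc n) (Delta n) (\<phi> n)"
    and \<phi>_open: "\<And>n z. z \<in> topspace (closed_disc n) \<Longrightarrow> \<phi> n z \<in> open_simplex n \<longleftrightarrow> (\<Sum>i<n. (z i)\<^sup>2) < 1"
    by metis
  have \<phi>_im: "\<phi> n ` topspace (closed_disc n) = standard_simplex n" for n
    using homeomorphic_imp_surjective_map[OF \<phi>, of n] by (simp add: topspace_Delta)
  have inj: "inj_on cell I"
  proof (rule inj_onI)
    fix a b assume ab: "a \<in> I" "b \<in> I" "cell a = cell b"
    obtain n \<alpha> m \<beta> where *: "a = (n, \<alpha>)" "\<alpha> \<in> F n" "b = (m, \<beta>)" "\<beta> \<in> F m"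
      using ab by (auto simp: I_def)
    have "point n \<alpha> (\<lambda>i. if i \<le> n then 1 / (real n + 1) else 0) \<in> cell a"
      using barycenter_in_open_simplex by (auto simp: cell_def *)
    then show "a = b"
      using cell_disjoint[OF *(2,4)] ab * by auto
  qed
  define ix where "ix = inv_into I cell"
  have ix: "ix (cell (n, \<alpha>)) = (n, \<alpha>)" if "\<alpha> \<in> F n" for n \<alpha>
    using inj that by (simp add: ix_def I_def)
  define dm where "dm e = fst (ix e)" for e
  define \<Phi> where "\<Phi> e = (\<lambda>z. point (fst (ix e)) (snd (ix e)) (\<phi> (fst (ix e)) z))" for e
  have C_cases: "\<exists>n \<alpha>. \<alpha> \<in> F n \<and> e = cell (n, \<alpha>) \<and> dm e = n \<and> \<Phi> e = point n \<alpha> \<circ> \<phi> n"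
    if e: "e \<in> C" for e
  proof -
    obtain n \<alpha> where "\<alpha> \<in> F n" "e = cell (n, \<alpha>)"
      using e by (auto simp: C_def I_def)
    then show ?thesis
      using ix by (intro exI[of _ n] exI[of _ \<alpha>]) (simp add: dm_def \<Phi>_def o_def)
  qed
  have "cw_structure ?X C dm \<Phi>"
    unfolding cw_structure_def
  proof (intro conjI ballI allI impI)
    show "\<Union>C = topspace ?X"
    proof
      show "\<Union>C \<subseteq> topspace ?X"
        unfolding C_def I_def cell_def open_simplex_def
        by (intro Union_least) (auto simp only: mem_Sigma_iff intro!: point_in_topspace)
      show "topspace ?X \<subseteq> \<Union>C"
      proof
        fix p assume "p \<in> topspace ?X"
        then obtain k \<alpha> y where "\<alpha> \<in> F k" "y \<in> open_simplex k" "p = point k \<alpha> y"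
          by (rule topspace_normal_form)
        then show "p \<in> \<Union>C"
          by (auto simp: C_def I_def cell_def)
      qed
    qed
    show "pairwise disjnt C"
      unfolding C_def I_def using cell_disjoint by (fastforce simp: pairwise_def disjnt_iff)
  next
    fix e assume "e \<in> C"
    then obtain n \<alpha> where e: "\<alpha> \<in> F n" "e = cell (n, \<alpha>)" "dm e = n" "\<Phi> e = point n \<alpha> \<circ> \<phi> n"
      using C_cases by blast
    show cont: "continuous_map (closed_disc (dm e)) ?X (\<Phi> e)"
      unfolding e(3,4)
      by (intro continuous_map_compose[OF homeomorphic_imp_continuous_map[OF \<phi>] continuous_map_point] e)
    have top_open: "topspace (open_disc n) = {z \<in> topspace (closed_disc n). (\<Sum>i<n. (z i)\<^sup>2) < 1}"
      by (auto simp: open_disc_def closed_disc_def)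
    have preimage: "{z \<in> topspace (closed_disc n). \<Phi> e z \<in> e} = topspace (open_disc n)"
    proof -
      have "\<Phi> e z \<in> e \<longleftrightarrow> \<phi> n z \<in> open_simplex n" if "z \<in> topspace (closed_disc n)" for z
        using point_in_cell_iff[OF e(1), of "\<phi> n z"] \<phi>_im that e by auto
      then show ?thesis
        using \<phi>_open by (auto simp: top_open)
    qed
    have disc: "subtopology (closed_disc n) (topspace (open_disc n)) = open_disc n"
    proof -
      have "{x. (\<Sum>i<n. (x i)\<^sup>2) \<le> 1} \<inter> topspace (open_disc n) =
          topspace (Euclidean_space n) \<inter> {x. (\<Sum>i<n. (x i)\<^sup>2) < 1}"
        by (auto simp: open_disc_def)
      then show ?thesis
        unfolding closed_disc_def subtopology_subtopology
        by (simp only: subtopology_restrict) (rule open_disc_def[symmetric])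
    qed
    have "closed_map (closed_disc n) ?X (\<Phi> e)"
      using cont compact_space_Delta[of n] homeomorphic_compact_space[OF homeomorphic_map_imp_homeomorphic_space[OF \<phi>[of n]]]
      by (intro continuous_imp_closed_map Hausdorff_space_geometric_realization) (auto simp: e(3))
    \<comment> \<open>The characteristic map is closed, and the open cell has the open disc as its preimage.
      Hence its restriction is closed onto the open cell.\<close>
    from closed_map_restriction[OF this preimage]
    have "closed_map (open_disc n) (subtopology ?X e) (\<Phi> e)"
      by (simp add: disc)
    moreover have "continuous_map (open_disc n) (subtopology ?X e) (\<Phi> e)"
    proof -
      have "continuous_map (open_disc n) ?X (\<Phi> e)"
        using continuous_map_from_subtopology[OF cont, of "topspace (open_disc n)"]
        unfolding e(3) disc .
      moreover have "\<Phi> e z \<in> e" if "z \<in> topspace (open_disc n)" for z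
        using preimage that by blast
      ultimately show ?thesis
        unfolding continuous_map_in_subtopology by blast
    qed
    moreover have "inj_on (\<Phi> e) (topspace (open_disc n))"
    proof (rule inj_onI)
      fix z w assume z: "z \<in> topspace (open_disc n)" and w: "w \<in> topspace (open_disc n)"
        and eq: "\<Phi> e z = \<Phi> e w"
      have zw: "z \<in> topspace (closed_disc n)" "w \<in> topspace (closed_disc n)"
        "\<phi> n z \<in> open_simplex n" "\<phi> n w \<in> open_simplex n"
        using z w \<phi>_open by (auto simp: top_open)
      have "n = n \<and> \<alpha> = \<alpha> \<and> \<phi> n w = \<phi> n z"
        by (rule interior_point_unique) (use e(1) zw eq in \<open>auto simp: e(4)\<close>)
      then show "z = w"
        using homeomorphic_imp_injective_map[OF \<phi>, of n] zw by (auto dest: inj_onD)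
    qed
    ultimately have "embedding_map (open_disc n) (subtopology ?X e) (\<Phi> e)"
      by (intro injective_closed_imp_embedding_map)
    then show "embedding_map (open_disc (dm e)) ?X (\<Phi> e)"
      by (simp add: embedding_map_in_subtopology e(3))
    have "open_simplex n \<subseteq> \<phi> n ` topspace (open_disc n)"
    proof
      fix x assume x: "x \<in> open_simplex n"
      then have "x \<in> \<phi> n ` topspace (closed_disc n)"
        by (simp add: \<phi>_im open_simplex_def)
      then show "x \<in> \<phi> n ` topspace (open_disc n)"
        using x \<phi>_open by (auto simp: top_open)
    qed
    then have im: "\<phi> n ` topspace (open_disc n) = open_simplex n"
      using \<phi>_open by (auto simp: top_open)
    show "\<Phi> e ` topspace (open_disc (dm e)) = e"
      unfolding e(3,4) image_comp[symmetric] im by (simp add: e(2) cell_def)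
    show "\<exists>K. finite K \<and> K \<subseteq> {e' \<in> C. dm e' < dm e} \<and> \<Phi> e ` disc_boundary (dm e) \<subseteq> \<Union>K"
    proof (intro exI conjI)
      let ?J = "SIGMA k:{..<n}. mor k n"
      let ?K = "(\<lambda>(k, \<sigma>). cell (k, act k n \<sigma> \<alpha>)) ` ?J"
      show "finite ?K"
        by (intro finite_imageI finite_SigmaI) auto
      show "?K \<subseteq> {e' \<in> C. dm e' < dm e}"
        using act_closed[OF _ e(1)] ix e(3) by (auto simp: C_def I_def dm_def)
      show "\<Phi> e ` disc_boundary (dm e) \<subseteq> \<Union>?K"
      proof
        fix p assume "p \<in> \<Phi> e ` disc_boundary (dm e)"
        then obtain z where z: "z \<in> disc_boundary n" "p = point n \<alpha> (\<phi> n z)"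
          by (auto simp: e(3,4))
        then have z': "z \<in> topspace (closed_disc n)" "\<not> (\<Sum>i<n. (z i)\<^sup>2) < 1"
          by (auto simp: disc_boundary_def closed_disc_def)
        then have "\<phi> n z \<in> standard_simplex n" "\<phi> n z \<notin> open_simplex n"
          using \<phi>_im \<phi>_open by auto
        then obtain k \<sigma> y where "k < n" "\<sigma> \<in> mor k n" "y \<in> open_simplex k" "p = point k (act k n \<sigma> \<alpha>) y"
          using point_normal_form[OF e(1), of "\<phi> n z"] z(2) by metis
        then show "p \<in> \<Union>?K"
          by (force simp: cell_def)
      qed
    qed
  next
    fix A assume A: "A \<subseteq> topspace ?X \<and> (\<forall>e\<in>C. closedin ?X (A \<inter> ?X closure_of e))"
    have "closedin (Delta n) {x \<in> topspace (Delta n). point n \<alpha> x \<in> A}" if \<alpha>: "\<alpha> \<in> F n" for n \<alpha>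
    proof -
      have "closedin ?X (A \<inter> ?X closure_of cell (n, \<alpha>))"
        using A \<alpha> by (auto simp: C_def I_def)
      from closedin_continuous_map_preimage[OF continuous_map_point[OF \<alpha>] this]
      show ?thesis
        using point_in_closure_of_cell[OF \<alpha>] by (simp add: topspace_Delta cong: conj_cong)
    qed
    then show "closedin ?X A"
      using A unfolding geometric_realization_def closedin_realization by blast
  qed
  then show ?thesis
    unfolding cw_complex_def using Hausdorff_space_geometric_realization by blast
qed

end

section \<open>The homotopy type of the random realization\<close>

lemma homotopy_equivalence_imp_homotopy_equivalent_space:
  "homotopy_equivalence X Y f \<Longrightarrow> X homotopy_equivalent_space Y"
  unfolding homotopy_equivalence_def homotopy_equivalent_space_def by blast

theorem theorem1p3:
  fixes M :: "'w measure"
    and F :: "nat \<Rightarrow> 'a set"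
    and act :: "nat \<Rightarrow> nat \<Rightarrow> (nat \<Rightarrow> nat) \<Rightarrow> 'a \<Rightarrow> 'a"
  assumes "prob_space M" and "complete_measure M" and "atomless M"
    and "pre_simplicial_set F act"
  shows "homotopy_equivalence (random_realization M F act) (geometric_realization F act)
           (law_map M F act) \<and>
         (\<exists>X :: (nat \<times> 'a \<times> (nat \<Rightarrow> real)) set topology.
            cw_complex X \<and> random_realization M F act homotopy_equivalent_space X)"
proof -
  interpret prob_space M by fact
  interpret pre_simplicial_set F act by fact
  obtain A :: "real \<Rightarrow> 'w set"
    where A: "\<And>t. A t \<in> events" "mono A" "\<And>t. t \<le> 0 \<Longrightarrow> A t = {}" "\<And>t. t \<ge> 1 \<Longrightarrow> A t = space M"
      "\<And>t. 0 \<le> t \<Longrightarrow> t \<le> 1 \<Longrightarrow> prob (A t) = t"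
    using \<open>atomless M\<close> by (rule atomless_event_chain) (rule that)
  interpret prob_chain M A
    by unfold_locales (fact A)+
  have "homotopy_equivalence (random_realization M F act) (geometric_realization F act)
      (law_map M F act)"
    by (rule homotopy_equivalence_law_map) fact
  then show ?thesis
    using cw_complex_geometric_realization homotopy_equivalence_imp_homotopy_equivalent_space
    by blast
qed

end
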